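(* Let $\mathcal{V}$ be a complex vector space, let $\Xi\subset\mathcal{V}_{nc}$ be a full nc subset, and let $\mathbf{A}$ be an algebra of nc functions from $\Xi$ into $\mathbb{C}_{nc}$ which contains the identity function $x\in\Xi_n\mapsto I_n$. Let $\Omega\subset\Xi$ be an $\mathbf{A}$-free open set and let $f:\Omega\to\mathbb{M}^1$ be an $\mathbf{A}$-free holomorphic function. If $K$ is an nc subset of $\Omega$ which is compact in the $\mathbf{A}$-free topology, then there exists $p\in\mathbf{A}$ such that $f(x)=p(x)$ for all $x\in K$. In particular (taking $\mathcal{V}=\mathbb{C}^d$, $\Xi=\mathbb{M}^d$ and $\mathbf{A}=\mathcal{P}_d$), every free holomorphic function on a free open set $\Omega\subset\mathbb{M}^d$ coincides with some free polynomial on each free compact nc subset of $\Omega$.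
   Context: Nc sets and functions. For a complex vector space $\mathcal{V}$, $\mathcal{V}^{m\times n}$ denotes the $m\times n$ matrices over $\mathcal{V}$, and $\mathcal{V}_{nc}=\coprod_{n\ge 1}\mathcal{V}^{n\times n}$. Complex matrices act on matrices over $\mathcal{V}$ from the left and right by the usual matrix multiplication. For $\Omega\subset\mathcal{V}_{nc}$, put $\Omega_n=\Omega\cap\mathcal{V}^{n\times n}$. $\Omega$ is an nc set if $x\in\Omega_n$, $y\in\Omega_m$ imply $x\oplus y=\begin{bmatrix}x&0\\0&y\end{bmatrix}\in\Omega_{n+m}$. A function $f:\Omega\to\mathcal{V}_{0,nc}$ ($\mathcal{V}_0$ a complex vector space) is graded if $f(x)\in\mathcal{V}_0^{n\times n}$ for $x\in\Omega_n$. A function $f$ on an nc set $\Omega$ is an nc function if it is graded and respects intertwinings: whenever $x\in\Omega_n$, $y\in\Omega_m$, $\alpha\in\mathbb{C}^{m\times n}$ satisfy $\alpha x=y\alpha$, then $\alpha f(x)=f(y)\alpha$. We write $\mathbb{M}^1=\mathbb{C}_{nc}=\coprod_{n\ge1}\mathbb{C}^{n\times n}$. Full nc set. An nc set $\Xi\subset\mathcal{V}_{nc}$ is a full nc subset if whenever $x\in\Xi_n$, $y\in\mathcal{V}^{m\times m}$ and $Iy=xI$ for some injective $I\in\mathbb{C}^{n\times m}$, then $y\in\Xi_m$. $\mathbf{A}$-free topology. $\mathbf{A}$ is an algebra (under pointwise operations) of nc functions $\Xi\to\mathbb{C}_{nc}$. For a finite-size $s\times r$ matrix $Q=[q_{ij}]$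 with entries in $\mathbf{A}$, and $z\in\Xi_n$, $Q(z)=[q_{ij}(z)]$ is viewed as a complex $sn\times rn$ matrix, and $\|Q(z)\|$ is its operator norm. The basic $\mathbf{A}$-free open sets are the nc sets $\mathbb{D}_Q=\{z\in\Xi : \|Q(z)\|<1\}$; they form a base of a topology on $\Xi$, called the $\mathbf{A}$-free topology. "$\mathbf{A}$-free open" and "$\mathbf{A}$-free compact" refer to this topology (compact means that every open cover has a finite subcover; the topology need not be Hausdorff). $\mathbf{A}$-free holomorphic. Let $\Omega\subset\Xi$ be $\mathbf{A}$-free open (not necessarily an nc set). A graded function $f:\Omega\to\mathbb{M}^1$ is $\mathbf{A}$-free holomorphic if for every $x\in\Omega$ there is a basic $\mathbf{A}$-free open set $\mathbb{D}_Q\subset\Omega$ containing $x$ such that $f|_{\mathbb{D}_Q}$ is a bounded nc function (bounded means $\sup_{z\in\mathbb{D}_Q}\|f(z)\|<\infty$ in operator norm). The free case. $(\mathbb{C}^d)^{n\times n}$ is identified with $\mathbb{M}_n^d=(\mathbb{C}^{n\times n})^d$, and $\mathbb{M}^d=\coprod_{n\ge1}\mathbb{M}_n^d$. $\mathcal{P}_d$ is the algebra of free (noncommutative) polynomials in $d$ variables, i.e. finite complex linear combinations of words (including the empty word), regarded as functions on $\mathbb{M}^d$ by evaluation. "Free open", "free compact", "free holomorphic" mean $\mathbf{A}$-free open, compact, holomorphic with $\Xi=\mathbb{M}^d$ and $\mathbf{A}=\mathcal{P}_d$. *)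

theory Defs
  imports
    "HOL-Analysis.Analysis"
    "HOL-Library.Poly_Mapping"
    "Jordan_Normal_Form.Matrix"
begin

text \<open>
  A complex vector space is a type \<open>'v\<close> of class \<open>ab_group_add\<close> together with a scalar
  multiplication \<open>scl\<close> satisfying \<^term>\<open>vector_space scl\<close>. Matrices over it, of all sizes at once,
  are elements of the type \<open>'v mat\<close>, so that \<open>\<Omega>\<^sub>n = \<Omega> \<inter> carrier_mat n n\<close>.
\<close>

definition nc_space :: "'v mat set" where
  "nc_space = {x. square_mat x \<and> 0 < dim_row x}"

definition left_act :: "(complex \<Rightarrow> 'v \<Rightarrow> 'v) \<Rightarrow> complex mat \<Rightarrow> 'v::ab_group_add mat \<Rightarrow> 'v mat" where
  "left_act scl \<alpha> x =
     mat (dim_row \<alpha>) (dim_col x) (\<lambda>(i,j). \<Sum>k<dim_row x. scl (\<alpha> $$ (i,k)) (x $$ (k,j)))"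

definition right_act :: "(complex \<Rightarrow> 'v \<Rightarrow> 'v) \<Rightarrow> 'v::ab_group_add mat \<Rightarrow> complex mat \<Rightarrow> 'v mat" where
  "right_act scl x \<alpha> =
     mat (dim_row x) (dim_col \<alpha>) (\<lambda>(i,j). \<Sum>k<dim_col x. scl (\<alpha> $$ (k,j)) (x $$ (i,k)))"

definition direct_sum :: "'v::zero mat \<Rightarrow> 'v mat \<Rightarrow> 'v mat" where
  "direct_sum x y =
     four_block_mat x (0\<^sub>m (dim_row x) (dim_col y)) (0\<^sub>m (dim_row y) (dim_col x)) y"

definition nc_set :: "'v::zero mat set \<Rightarrow> bool" where
  "nc_set \<Omega> \<longleftrightarrow> \<Omega> \<subseteq> nc_space \<and> (\<forall>x\<in>\<Omega>. \<forall>y\<in>\<Omega>. direct_sum x y \<in> \<Omega>)"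

definition full_nc_set :: "(complex \<Rightarrow> 'v \<Rightarrow> 'v) \<Rightarrow> 'v::ab_group_add mat set \<Rightarrow> bool" where
  "full_nc_set scl \<Xi> \<longleftrightarrow> nc_set \<Xi> \<and>
     (\<forall>x\<in>\<Xi>. \<forall>y\<in>nc_space. \<forall>I\<in>carrier_mat (dim_row x) (dim_row y).
        inj_on (\<lambda>v. I *\<^sub>v v) (carrier_vec (dim_row y)) \<and> left_act scl I y = right_act scl x I
          \<longrightarrow> y \<in> \<Xi>)"

text \<open>
  Functions on a set \<open>\<Omega>\<close> of matrices are total HOL functions of which only the values on \<open>\<Omega>\<close> matter.
\<close>

definition graded_on :: "'v mat set \<Rightarrow> ('v mat \<Rightarrow> complex mat) \<Rightarrow> bool" where
  "graded_on \<Omega> f \<longleftrightarrow> (\<forall>x\<in>\<Omega>. f x \<in> carrier_mat (dim_row x) (dim_row x))"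

definition nc_function ::
    "(complex \<Rightarrow> 'v \<Rightarrow> 'v) \<Rightarrow> 'v::ab_group_add mat set \<Rightarrow> ('v mat \<Rightarrow> complex mat) \<Rightarrow> bool" where
  "nc_function scl \<Omega> f \<longleftrightarrow> graded_on \<Omega> f \<and>
     (\<forall>x\<in>\<Omega>. \<forall>y\<in>\<Omega>. \<forall>\<alpha>\<in>carrier_mat (dim_row y) (dim_row x).
        left_act scl \<alpha> x = right_act scl y \<alpha> \<longrightarrow> \<alpha> * f x = f y * \<alpha>)"

text \<open>
  Since functions are only considered on \<open>\<Xi>\<close>, closure under the pointwise operations means that some
  member of the algebra agrees on \<open>\<Xi>\<close> with the pointwise sum, scalar multiple or product.
\<close>

definition nc_function_algebra ::
    "(complex \<Rightarrow> 'v \<Rightarrow> 'v) \<Rightarrow> 'v::ab_group_add mat set \<Rightarrow> ('v mat \<Rightarrow> complex mat) set \<Rightarrow> bool" where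
  "nc_function_algebra scl \<Xi> A \<longleftrightarrow> A \<noteq> {} \<and> (\<forall>p\<in>A. nc_function scl \<Xi> p) \<and>
     (\<forall>p\<in>A. \<forall>q\<in>A. \<exists>r\<in>A. \<forall>x\<in>\<Xi>. r x = p x + q x) \<and>
     (\<forall>c. \<forall>p\<in>A. \<exists>r\<in>A. \<forall>x\<in>\<Xi>. r x = c \<cdot>\<^sub>m p x) \<and>
     (\<forall>p\<in>A. \<forall>q\<in>A. \<exists>r\<in>A. \<forall>x\<in>\<Xi>. r x = p x * q x)"

definition op_norm :: "complex mat \<Rightarrow> real" where
  "op_norm M = Sup ((\<lambda>v. L2_set (\<lambda>i. cmod (vec_index (M *\<^sub>v v) i)) {..<dim_row M}) `
     {v \<in> carrier_vec (dim_col M). L2_set (\<lambda>j. cmod (vec_index v j)) {..<dim_col M} \<le> 1})"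

text \<open>
  For \<open>z\<close> of size \<open>n\<close> and \<open>Q\<close> of size \<open>s \<times> r\<close>, the \<open>sn \<times> rn\<close> matrix whose \<open>n \<times> n\<close> block at
  position \<open>(i, j)\<close> is \<open>q\<^sub>i\<^sub>j(z)\<close>.
\<close>

definition mat_fun_eval :: "('v mat \<Rightarrow> complex mat) mat \<Rightarrow> 'v mat \<Rightarrow> complex mat" where
  "mat_fun_eval Q z = (let n = dim_row z in
     mat (dim_row Q * n) (dim_col Q * n)
       (\<lambda>(i,j). (Q $$ (i div n, j div n)) z $$ (i mod n, j mod n)))"

definition basic_free_open ::
    "'v mat set \<Rightarrow> ('v mat \<Rightarrow> complex mat) mat \<Rightarrow> 'v mat set" where
  "basic_free_open \<Xi> Q = {z \<in> \<Xi>. op_norm (mat_fun_eval Q z) < 1}"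

definition matrices_over :: "'a set \<Rightarrow> 'a mat set" where
  "matrices_over A = {Q. 0 < dim_row Q \<and> 0 < dim_col Q \<and> elements_mat Q \<subseteq> A}"

text \<open>
  The basic sets are closed under finite intersections, \<open>\<D>\<^sub>P \<inter> \<D>\<^sub>Q = \<D>\<^bsub>P \<oplus> Q\<^esub>\<close>, and cover \<open>\<Xi> = \<D>\<^sub>0\<close>,
  when \<open>A\<close> is an algebra; hence they are a base of the topology they generate.
\<close>

definition free_topology ::
    "'v mat set \<Rightarrow> ('v mat \<Rightarrow> complex mat) set \<Rightarrow> 'v mat topology" where
  "free_topology \<Xi> A = topology_generated_by (basic_free_open \<Xi> ` matrices_over A)"

definition free_holomorphic ::
    "(complex \<Rightarrow> 'v \<Rightarrow> 'v) \<Rightarrow> 'v::ab_group_add mat set \<Rightarrow> ('v mat \<Rightarrow> complex mat) set \<Rightarrow>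
     'v mat set \<Rightarrow> ('v mat \<Rightarrow> complex mat) \<Rightarrow> bool" where
  "free_holomorphic scl \<Xi> A \<Omega> f \<longleftrightarrow> graded_on \<Omega> f \<and>
     (\<forall>x\<in>\<Omega>. \<exists>Q\<in>matrices_over A.
        x \<in> basic_free_open \<Xi> Q \<and> basic_free_open \<Xi> Q \<subseteq> \<Omega> \<and>
        nc_function scl (basic_free_open \<Xi> Q) f \<and>
        (\<exists>C. \<forall>z\<in>basic_free_open \<Xi> Q. op_norm (f z) \<le> C))"

text \<open>
  Free polynomials in the noncommuting variables indexed by the finite type \<open>'d\<close>: finitely supported
  coefficient families on words. A \<open>d\<close>-tuple of \<open>n \<times> n\<close> matrices is an \<open>n \<times> n\<close> matrix over
  \<open>\<complex>\<^sup>d\<close>, with \<open>coord_mat x k\<close> its \<open>k\<close>-th member.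
\<close>

type_synonym 'd free_poly = "'d list \<Rightarrow>\<^sub>0 complex"

definition coord_mat :: "(complex ^ 'd) mat \<Rightarrow> 'd \<Rightarrow> complex mat" where
  "coord_mat x k = map_mat (\<lambda>v. vec_nth v k) x"

definition word_eval :: "'d list \<Rightarrow> (complex ^ 'd) mat \<Rightarrow> complex mat" where
  "word_eval w x = foldr (\<lambda>k M. coord_mat x k * M) w (1\<^sub>m (dim_row x))"

text \<open>The sum is taken entrywise because matrices of varying size are not an additive monoid.\<close>

definition free_poly_eval :: "'d free_poly \<Rightarrow> (complex ^ 'd) mat \<Rightarrow> complex mat" where
  "free_poly_eval p x = mat (dim_row x) (dim_row x)
     (\<lambda>(i,j). \<Sum>w\<in>Poly_Mapping.keys p. Poly_Mapping.lookup p w * word_eval w x $$ (i,j))"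

end

theory Submission
  imports Defs
begin

text \<open>
  Let \<open>f\<close> be a bounded nc function on \<open>\<D>\<^sub>Q\<close> and \<open>x \<in> \<D>\<^sub>Q\<close>. If \<open>P\<close> is the orthogonal projection onto a
  subspace invariant under all \<open>q(x)\<close>, \<open>q \<in> A\<close>, and \<open>S = P + t (1 - P)\<close> with \<open>0 < t \<le> 1\<close>, then
  \<open>S\<inverse> x S\<close> stays in \<open>\<D>\<^sub>Q\<close>, while the corner \<open>(1 - P) f(x) P\<close> is multiplied by \<open>1/t\<close>. As \<open>f\<close> is
  bounded, this corner vanishes, so \<open>f(x)\<close> leaves every subspace \<open>A(x) v\<close> invariant; applied to a direct
  sum of copies of \<open>x\<close> this gives \<open>f(x) \<in> A(x)\<close>.

  Since basic free open sets are closed under direct sums and summands, an nc compact set \<open>K\<close> covered by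
  basic sets is contained in one of them. Hence some \<open>x \<in> K\<close> has the property that every \<open>q \<in> A\<close> with
  \<open>q(x) = 0\<close> vanishes on \<open>K\<close>. Choosing \<open>p\<close> with \<open>p(x) = f(x)\<close> and, for \<open>z \<in> K\<close>, \<open>q\<close> with
  \<open>q(x \<oplus> z) = f(x \<oplus> z)\<close>, we get \<open>(p - q)(x) = 0\<close>, so \<open>f(z) = q(z) = p(z)\<close>.
\<close>

section \<open>Actions of scalar matrices and direct sums\<close>

text \<open>Two obstacles shape the argument. First, conjugation by \<open>S\<close> normally
  inflates norms by the condition number of \<open>S\<close>, which blows up as \<open>t\<close>
  tends to 0, while the bound on \<open>f\<close> holds only inside one fixed \<open>\<D>_Q\<close>.
  What saves it is the identity \<open>T B S = B + (1 - t) (B P - P B)\<close>, with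
  \<open>T\<close> the inverse of \<open>S\<close>, for every \<open>B\<close> that leaves the range
  of \<open>P\<close> invariant. The right side is a convex combination of \<open>B\<close> and its
  unitary conjugate \<open>U B U\<close>, with the same weights for all entries of \<open>Q\<close>,
  so the whole family stays in the ball. Fullness is what makes the conjugated point a member of
  \<open>\<Xi>\<close> at all.

  Second, \<open>f\<close> is an nc function only on each basic set separately, and the element of
  \<open>A\<close> that interpolates it depends on the point. Values at different points are
  therefore compared only through a direct sum: any basic set around the sum also contains the
  summands, and one element of \<open>A\<close> then serves them together.

  The unit of \<open>A\<close> enters because \<open>v\<close> must lie in its own orbit
  \<open>A(x) v\<close>.\<close>

lemma mult_mat_entry:
  fixes A B :: "'a::semiring_0 mat"
  assumes "A \<in> carrier_mat n m" "B \<in> carrier_mat m l" "i < n" "j < l"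
  shows "(A * B) $$ (i,j) = (\<Sum>k<m. A $$ (i,k) * B $$ (k,j))"
  using assms by (auto simp: scalar_prod_def lessThan_atLeast0 intro!: sum.cong)

lemma mult_mat_vec_entry:
  fixes A :: "'a::semiring_0 mat"
  assumes "A \<in> carrier_mat n m" "v \<in> carrier_vec m" "i < n"
  shows "vec_index (A *\<^sub>v v) i = (\<Sum>k<m. A $$ (i,k) * vec_index v k)"
  using assms by (auto simp: scalar_prod_def lessThan_atLeast0 intro!: sum.cong)

locale complex_space = vector_space scl
  for scl :: "complex \<Rightarrow> 'v::ab_group_add \<Rightarrow> 'v"
begin

lemma left_act_carrier:
  "\<alpha> \<in> carrier_mat a b \<Longrightarrow> x \<in> carrier_mat b c \<Longrightarrow> left_act scl \<alpha> x \<in> carrier_mat a c"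
  by (simp add: left_act_def)

lemma right_act_carrier:
  "x \<in> carrier_mat a b \<Longrightarrow> \<alpha> \<in> carrier_mat b c \<Longrightarrow> right_act scl x \<alpha> \<in> carrier_mat a c"
  by (simp add: right_act_def)

lemma left_act_mult:
  assumes "\<alpha> \<in> carrier_mat a b" "\<beta> \<in> carrier_mat b c" "x \<in> carrier_mat c d"
  shows "left_act scl (\<alpha> * \<beta>) x = left_act scl \<alpha> (left_act scl \<beta> x)"
proof (rule eq_matI)
  fix i j assume "i < dim_row (left_act scl \<alpha> (left_act scl \<beta> x))"
    "j < dim_col (left_act scl \<alpha> (left_act scl \<beta> x))"
  then have ij: "i < a" "j < d" using assms by (auto simp: left_act_def)
  have "left_act scl (\<alpha> * \<beta>) x $$ (i,j) =
      (\<Sum>k<c. \<Sum>l<b. scl (\<alpha> $$ (i,l)) (scl (\<beta> $$ (l,k)) (x $$ (k,j))))"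
    using assms ij
    by (auto simp: left_act_def mult_mat_entry[OF assms(1,2)] scale_sum_left simp del: index_mult_mat(1) intro!: sum.cong)
  also have "\<dots> = left_act scl \<alpha> (left_act scl \<beta> x) $$ (i,j)"
    using assms ij by (subst sum.swap) (auto simp: left_act_def scale_sum_right intro!: sum.cong)
  finally show "left_act scl (\<alpha> * \<beta>) x $$ (i,j) = left_act scl \<alpha> (left_act scl \<beta> x) $$ (i,j)" .
qed (use assms in \<open>auto simp: left_act_def\<close>)

lemma right_act_mult:
  assumes "x \<in> carrier_mat a b" "\<alpha> \<in> carrier_mat b c" "\<beta> \<in> carrier_mat c d"
  shows "right_act scl x (\<alpha> * \<beta>) = right_act scl (right_act scl x \<alpha>) \<beta>"
proof (rule eq_matI)
  fix i j assume "i < dim_row (right_act scl (right_act scl x \<alpha>) \<beta>)"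
    "j < dim_col (right_act scl (right_act scl x \<alpha>) \<beta>)"
  then have ij: "i < a" "j < d" using assms by (auto simp: right_act_def)
  have "right_act scl x (\<alpha> * \<beta>) $$ (i,j) =
      (\<Sum>k<b. \<Sum>l<c. scl (\<beta> $$ (l,j)) (scl (\<alpha> $$ (k,l)) (x $$ (i,k))))"
    using assms ij
    by (auto simp: right_act_def mult_mat_entry[OF assms(2,3)] scale_sum_left mult.commute simp del: index_mult_mat(1) intro!: sum.cong)
  also have "\<dots> = right_act scl (right_act scl x \<alpha>) \<beta> $$ (i,j)"
    using assms ij by (subst sum.swap) (auto simp: right_act_def scale_sum_right intro!: sum.cong)
  finally show "right_act scl x (\<alpha> * \<beta>) $$ (i,j) = right_act scl (right_act scl x \<alpha>) \<beta> $$ (i,j)" .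
qed (use assms in \<open>auto simp: right_act_def\<close>)

lemma left_right_act:
  assumes "\<alpha> \<in> carrier_mat a b" "x \<in> carrier_mat b c" "\<beta> \<in> carrier_mat c d"
  shows "left_act scl \<alpha> (right_act scl x \<beta>) = right_act scl (left_act scl \<alpha> x) \<beta>"
proof (rule eq_matI)
  fix i j assume "i < dim_row (right_act scl (left_act scl \<alpha> x) \<beta>)"
    "j < dim_col (right_act scl (left_act scl \<alpha> x) \<beta>)"
  then have ij: "i < a" "j < d" using assms by (auto simp: right_act_def left_act_def)
  have "left_act scl \<alpha> (right_act scl x \<beta>) $$ (i,j) =
      (\<Sum>k<b. \<Sum>l<c. scl (\<alpha> $$ (i,k)) (scl (\<beta> $$ (l,j)) (x $$ (k,l))))"
    using assms ij by (auto simp: right_act_def left_act_def scale_sum_right intro!: sum.cong)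
  also have "\<dots> = right_act scl (left_act scl \<alpha> x) \<beta> $$ (i,j)"
    using assms ij
    by (subst sum.swap) (auto simp: right_act_def left_act_def scale_sum_right mult.commute intro!: sum.cong)
  finally show "left_act scl \<alpha> (right_act scl x \<beta>) $$ (i,j) = right_act scl (left_act scl \<alpha> x) \<beta> $$ (i,j)" .
qed (use assms in \<open>auto simp: right_act_def left_act_def\<close>)

lemma scale_if: "scl (if P then 1 else 0) v = (if P then v else 0)"
  by simp

lemma left_act_one: "x \<in> carrier_mat a b \<Longrightarrow> left_act scl (1\<^sub>m a) x = x"
  by (rule eq_matI) (auto simp: left_act_def scale_if)

text \<open>The chain is
  \<open>\<beta> \<alpha> x = \<beta> y \<alpha> = z \<beta> \<alpha>\<close>; the three
  associativity lemmas above move the brackets.\<close>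

lemma intertwining_comp:
  assumes "x \<in> carrier_mat a a" "y \<in> carrier_mat b b" "z \<in> carrier_mat c c"
    and "\<alpha> \<in> carrier_mat b a" "\<beta> \<in> carrier_mat c b"
    and "left_act scl \<alpha> x = right_act scl y \<alpha>" "left_act scl \<beta> y = right_act scl z \<beta>"
  shows "left_act scl (\<beta> * \<alpha>) x = right_act scl z (\<beta> * \<alpha>)"
  using left_act_mult[OF assms(5,4,1)] left_right_act[OF assms(5,2,4)]
    right_act_mult[OF assms(3,5,4)] assms(6,7) by simp

end

section \<open>Coordinate projections [1 0], [0 1] of a direct sum and their transposes, the
  inclusions\<close>

definition proj1 :: "nat \<Rightarrow> nat \<Rightarrow> complex mat" where
  "proj1 n m = mat n (n + m) (\<lambda>(i,j). if j = i then 1 else 0)"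

definition proj2 :: "nat \<Rightarrow> nat \<Rightarrow> complex mat" where
  "proj2 n m = mat m (n + m) (\<lambda>(i,j). if j = n + i then 1 else 0)"

definition incl1 :: "nat \<Rightarrow> nat \<Rightarrow> complex mat" where
  "incl1 n m = mat (n + m) n (\<lambda>(i,j). if i = j then 1 else 0)"

definition incl2 :: "nat \<Rightarrow> nat \<Rightarrow> complex mat" where
  "incl2 n m = mat (n + m) m (\<lambda>(i,j). if i = n + j then 1 else 0)"

lemma proj_incl_carrier [simp]:
  "proj1 n m \<in> carrier_mat n (n + m)" "proj2 n m \<in> carrier_mat m (n + m)"
  "incl1 n m \<in> carrier_mat (n + m) n" "incl2 n m \<in> carrier_mat (n + m) m"
  "dim_row (proj1 n m) = n" "dim_col (proj1 n m) = n + m"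
  "dim_row (proj2 n m) = m" "dim_col (proj2 n m) = n + m"
  "dim_row (incl1 n m) = n + m" "dim_col (incl1 n m) = n"
  "dim_row (incl2 n m) = n + m" "dim_col (incl2 n m) = m"
  by (auto simp: proj1_def proj2_def incl1_def incl2_def)

lemma if_mult: "(if P then 1 else 0) * (a::'a::semiring_1) = (if P then a else 0)"
  "a * (if P then 1 else 0) = (if P then a else 0)"
  by auto

lemma proj_incl:
  "proj1 n m * incl1 n m = 1\<^sub>m n" "proj2 n m * incl2 n m = 1\<^sub>m m"
proof -
  show "proj1 n m * incl1 n m = 1\<^sub>m n"
    by (rule eq_matI)
      (auto simp: mult_mat_entry[of _ n "n + m" _ n] proj1_def incl1_def if_mult simp del: index_mult_mat(1))
  show "proj2 n m * incl2 n m = 1\<^sub>m m"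
    by (rule eq_matI)
      (auto simp: mult_mat_entry[of _ m "n + m" _ m] proj2_def incl2_def if_mult simp del: index_mult_mat(1))
qed

lemma incl_proj: "incl1 n m * proj1 n m + incl2 n m * proj2 n m = 1\<^sub>m (n + m)"
proof (rule eq_matI)
  fix i j assume "i < dim_row (1\<^sub>m (n + m) :: complex mat)" "j < dim_col (1\<^sub>m (n + m) :: complex mat)"
  then have ij: "i < n + m" "j < n + m" by auto
  have "(\<Sum>k<n. (if i = k then 1 else 0) * (if j = k then 1 else (0::complex))) = (if i = j \<and> i < n then 1 else 0)"
    by (auto simp: if_mult)
  \<comment> \<open>Solving for \<open>k\<close> turns the summand into an indicator of one index.
    Subtraction on naturals truncates, so the guard \<open>n \<le> i\<close> has to accompany
    \<open>k = i - n\<close>.\<close>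
  moreover have "(\<Sum>k<m. (if i = n + k then 1 else 0) * (if j = n + k then 1 else (0::complex))) =
      (\<Sum>k<m. if k = i - n \<and> n \<le> i \<and> i = j then 1 else 0)"
    by (rule sum.cong) auto
  moreover have "\<dots> = (if i = j \<and> n \<le> i then 1 else 0)"
  proof (cases "n \<le> i \<and> i = j")
    case True
    then have "i - n < m" using ij by auto
    with True show ?thesis by simp
  qed (auto intro!: sum.neutral)
  ultimately show "(incl1 n m * proj1 n m + incl2 n m * proj2 n m) $$ (i,j) = 1\<^sub>m (n + m) $$ (i,j)"
    using ij
    by (auto simp: mult_mat_entry[of _ "n + m" n _ "n + m"] mult_mat_entry[of _ "n + m" m _ "n + m"]
        proj1_def proj2_def incl1_def incl2_def simp del: index_mult_mat(1))
qed auto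

lemma direct_sum_carrier:
  "x \<in> carrier_mat n n \<Longrightarrow> y \<in> carrier_mat m m \<Longrightarrow> direct_sum x y \<in> carrier_mat (n + m) (n + m)"
  by (auto simp: direct_sum_def)

lemma direct_sum_entry:
  assumes "x \<in> carrier_mat n n" "y \<in> carrier_mat m m" "i < n + m" "j < n + m"
  shows "direct_sum x y $$ (i,j) =
    (if i < n \<and> j < n then x $$ (i,j) else if n \<le> i \<and> n \<le> j then y $$ (i - n, j - n) else 0)"
  using assms by (auto simp: direct_sum_def)

context complex_space
begin

lemma proj1_intertwines:
  assumes x: "x \<in> carrier_mat n n" and y: "y \<in> carrier_mat m m"
  shows "left_act scl (proj1 n m) (direct_sum x y) = right_act scl x (proj1 n m)"
  using x y direct_sum_carrier[OF x y]
  by (intro eq_matI)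
    (auto simp: left_act_def right_act_def proj1_def scale_if direct_sum_entry[OF x y])

lemma proj2_intertwines:
  assumes x: "x \<in> carrier_mat n n" and y: "y \<in> carrier_mat m m"
  shows "left_act scl (proj2 n m) (direct_sum x y) = right_act scl y (proj2 n m)"
proof (rule eq_matI)
  fix i j assume "i < dim_row (right_act scl y (proj2 n m))" "j < dim_col (right_act scl y (proj2 n m))"
  then have ij: "i < m" "j < n + m" using y by (auto simp: right_act_def)
  have "(\<Sum>k<m. if j = n + k then y $$ (i,k) else 0) =
      (\<Sum>k<m. if k = j - n then if n \<le> j then y $$ (i,k) else 0 else 0)"
    by (rule sum.cong) auto
  also have "\<dots> = (if n \<le> j then y $$ (i, j - n) else 0)"
    using ij by auto
  finally show "left_act scl (proj2 n m) (direct_sum x y) $$ (i,j) = right_act scl y (proj2 n m) $$ (i,j)"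
    using ij x y direct_sum_carrier[OF x y]
    by (auto simp: left_act_def right_act_def proj2_def scale_if direct_sum_entry[OF x y])
qed (use x y direct_sum_carrier[OF x y] in \<open>auto simp: left_act_def right_act_def\<close>)

lemma nc_function_intertwines:
  assumes "nc_function scl \<Omega> f" "x \<in> \<Omega>" "y \<in> \<Omega>" "x \<in> carrier_mat n n" "y \<in> carrier_mat m m"
    and "\<alpha> \<in> carrier_mat m n" "left_act scl \<alpha> x = right_act scl y \<alpha>"
  shows "\<alpha> * f x = f y * \<alpha>"
  using assms unfolding nc_function_def by blast

lemma nc_function_carrier:
  assumes "nc_function scl \<Omega> f" "x \<in> \<Omega>" "x \<in> carrier_mat n n"
  shows "f x \<in> carrier_mat n n"
  using assms by (auto simp: nc_function_def graded_on_def)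

text \<open>The intertwinings by the two projections fix the upper and the lower block row of
  \<open>f (direct_sum x y)\<close>; the inclusions are right inverses of the projections, and
  \<open>incl_proj\<close> reassembles the matrix from its rows. Membership of the three points is
  assumed instead of closure of \<open>\<Omega>\<close>, so that the lemma serves both
  \<open>A\<close> on \<open>\<Xi>\<close> and \<open>f\<close> on a basic set.\<close>

lemma nc_function_direct_sum:
  assumes f: "nc_function scl \<Omega> f" and mem: "x \<in> \<Omega>" "y \<in> \<Omega>" "direct_sum x y \<in> \<Omega>"
    and x: "x \<in> carrier_mat n n" and y: "y \<in> carrier_mat m m"
  shows "f x = proj1 n m * f (direct_sum x y) * incl1 n m"
    and "f y = proj2 n m * f (direct_sum x y) * incl2 n m"
    and "f (direct_sum x y) = incl1 n m * f x * proj1 n m + incl2 n m * f y * proj2 n m"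
proof -
  note xy = direct_sum_carrier[OF x y]
  note fx = nc_function_carrier[OF f mem(1) x] and fy = nc_function_carrier[OF f mem(2) y]
    and fxy = nc_function_carrier[OF f mem(3) xy]
  have p: "proj1 n m * f (direct_sum x y) = f x * proj1 n m" "proj2 n m * f (direct_sum x y) = f y * proj2 n m"
    using nc_function_intertwines[OF f mem(3,1) xy x _ proj1_intertwines[OF x y]]
      nc_function_intertwines[OF f mem(3,2) xy y _ proj2_intertwines[OF x y]] by auto
  show "f x = proj1 n m * f (direct_sum x y) * incl1 n m" "f y = proj2 n m * f (direct_sum x y) * incl2 n m"
    unfolding p using fx fy by (auto simp: assoc_mult_mat[of _ n n _ "n+m" _ n] assoc_mult_mat[of _ m m _ "n+m" _ m] proj_incl)
  have "f (direct_sum x y) = (incl1 n m * proj1 n m + incl2 n m * proj2 n m) * f (direct_sum x y)"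
    using fxy by (simp add: incl_proj)
  also have "\<dots> = incl1 n m * (proj1 n m * f (direct_sum x y)) + incl2 n m * (proj2 n m * f (direct_sum x y))"
    using fxy by (subst add_mult_distrib_mat[of _ "n+m" "n+m"])
      (auto simp: assoc_mult_mat[of _ "n+m" n _ "n+m" _ "n+m"] assoc_mult_mat[of _ "n+m" m _ "n+m" _ "n+m"])
  also have "\<dots> = incl1 n m * f x * proj1 n m + incl2 n m * f y * proj2 n m"
    unfolding p using fx fy by (simp add: assoc_mult_mat[of _ "n+m" n _ n _ "n+m"] assoc_mult_mat[of _ "n+m" m _ m _ "n+m"])
  finally show "f (direct_sum x y) = incl1 n m * f x * proj1 n m + incl2 n m * f y * proj2 n m" .
qed

end

section \<open>Operator norms\<close>

text \<open>The squared Euclidean norm. Squares are preferred to norms because they add up over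
  blocks and over direct summands.\<close>

definition sqnorm :: "complex Matrix.vec \<Rightarrow> real" where
  "sqnorm v = (\<Sum>i<dim_vec v. (cmod (vec_index v i))\<^sup>2)"

lemma sqnorm_nonneg [simp]: "0 \<le> sqnorm v"
  by (simp add: sqnorm_def sum_nonneg)

lemma L2_set_sqnorm: "n = dim_vec v \<Longrightarrow> L2_set (\<lambda>i. cmod (vec_index v i)) {..<n} = sqrt (sqnorm v)"
  by (simp add: L2_set_def sqnorm_def)

lemma sqnorm_smult: "sqnorm (c \<cdot>\<^sub>v v) = (cmod c)\<^sup>2 * sqnorm v"
  by (simp add: sqnorm_def norm_mult power_mult_distrib sum_distrib_left)

lemma sqnorm_entry: "i < dim_vec v \<Longrightarrow> (cmod (vec_index v i))\<^sup>2 \<le> sqnorm v"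
  unfolding sqnorm_def by (rule member_le_sum) auto

lemma sqnorm_eq_0: "sqnorm v = 0 \<longleftrightarrow> v = 0\<^sub>v (dim_vec v)"
  by (auto simp: sqnorm_def sum_nonneg_eq_0_iff vec_eq_iff)

lemma sqrt_sqnorm_le: "sqrt (sqnorm v) \<le> (\<Sum>i<dim_vec v. cmod (vec_index v i))"
  using L2_set_le_sum[of "{..<dim_vec v}" "\<lambda>i. cmod (vec_index v i)"] by (simp add: L2_set_sqnorm)

lemma op_norm_alt:
  "op_norm M = (SUP v\<in>{v \<in> carrier_vec (dim_col M). sqnorm v \<le> 1}. sqrt (sqnorm (M *\<^sub>v v)))"
proof -
  have "(\<lambda>v. L2_set (\<lambda>i. cmod (vec_index (M *\<^sub>v v) i)) {..<dim_row M}) = (\<lambda>v. sqrt (sqnorm (M *\<^sub>v v)))"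
    by (intro ext L2_set_sqnorm) simp
  moreover have "{v \<in> carrier_vec (dim_col M). L2_set (\<lambda>j. cmod (vec_index v j)) {..<dim_col M} \<le> 1} =
      {v \<in> carrier_vec (dim_col M). sqnorm v \<le> 1}"
    by (auto simp: L2_set_sqnorm)
  ultimately show ?thesis unfolding op_norm_def by (simp only:)
qed

text \<open>A real supremum carries information only for a bounded set. On the unit ball every
  coordinate of \<open>v\<close> has modulus at most 1, so the sum of the moduli of all entries of
  \<open>M\<close> is a crude bound.\<close>

lemma op_norm_bdd_above:
  "bdd_above ((\<lambda>v. sqrt (sqnorm (M *\<^sub>v v))) ` {v \<in> carrier_vec (dim_col M). sqnorm v \<le> 1})"
proof (rule bdd_aboveI2)
  fix v assume v: "v \<in> {v \<in> carrier_vec (dim_col M). sqnorm v \<le> 1}"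
  have e: "cmod (vec_index v j) \<le> 1" if "j < dim_col M" for j
  proof -
    have "(cmod (vec_index v j))\<^sup>2 \<le> 1" using sqnorm_entry[of j v] v that by auto
    then show ?thesis by (simp add: abs_square_le_1)
  qed
  have "sqrt (sqnorm (M *\<^sub>v v)) \<le> (\<Sum>i<dim_row M. cmod (vec_index (M *\<^sub>v v) i))"
    using sqrt_sqnorm_le[of "M *\<^sub>v v"] by simp
  also have "\<dots> \<le> (\<Sum>i<dim_row M. \<Sum>j<dim_col M. cmod (M $$ (i,j)))"
  proof (rule sum_mono)
    fix i assume "i \<in> {..<dim_row M}"
    then have "cmod (vec_index (M *\<^sub>v v) i) = cmod (\<Sum>j<dim_col M. M $$ (i,j) * vec_index v j)"
      using v by (subst mult_mat_vec_entry[of M "dim_row M" "dim_col M"]) auto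
    also have "\<dots> \<le> (\<Sum>j<dim_col M. cmod (M $$ (i,j) * vec_index v j))" by (rule norm_sum)
    also have "\<dots> \<le> (\<Sum>j<dim_col M. cmod (M $$ (i,j)))"
      using e by (intro sum_mono) (auto simp: norm_mult intro: mult_left_le)
    finally show "cmod (vec_index (M *\<^sub>v v) i) \<le> (\<Sum>j<dim_col M. cmod (M $$ (i,j)))" .
  qed
  finally show "sqrt (sqnorm (M *\<^sub>v v)) \<le> (\<Sum>i<dim_row M. \<Sum>j<dim_col M. cmod (M $$ (i,j)))" .
qed

lemma op_norm_nonneg: "0 \<le> op_norm M"
proof -
  have "sqrt (sqnorm (M *\<^sub>v 0\<^sub>v (dim_col M))) \<le> op_norm M"
    unfolding op_norm_alt by (rule cSUP_upper[OF _ op_norm_bdd_above]) (auto simp: sqnorm_def)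
  then show ?thesis by (rule order_trans[rotated]) simp
qed

lemma op_norm_bound:
  assumes v: "v \<in> carrier_vec (dim_col M)"
  shows "sqnorm (M *\<^sub>v v) \<le> (op_norm M)\<^sup>2 * sqnorm v"
proof (cases "sqnorm v = 0")
  case True
  then have "v = 0\<^sub>v (dim_col M)" using v by (simp add: sqnorm_eq_0)
  then have "M *\<^sub>v v = 0\<^sub>v (dim_row M)" by (auto simp: vec_eq_iff scalar_prod_def)
  then show ?thesis using True by (simp add: sqnorm_def)
next
  case False
  define s where "s = sqrt (sqnorm v)"
  have s: "0 < s" "s\<^sup>2 = sqnorm v" using False sqnorm_nonneg[of v] by (auto simp: s_def less_le)
  define u where "u = complex_of_real (1 / s) \<cdot>\<^sub>v v"
  have "sqnorm u = 1" using s False by (simp add: u_def sqnorm_smult norm_divide power_divide)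
  then have "sqrt (sqnorm (M *\<^sub>v u)) \<le> op_norm M"
    unfolding op_norm_alt using v by (intro cSUP_upper[OF _ op_norm_bdd_above]) (auto simp: u_def)
  then have "sqnorm (M *\<^sub>v u) \<le> (op_norm M)\<^sup>2"
    by (rule sqrt_le_D)
  moreover have "M *\<^sub>v u = complex_of_real (1 / s) \<cdot>\<^sub>v (M *\<^sub>v v)"
    unfolding u_def using v by (intro mult_mat_vec) auto
  ultimately have "sqnorm (M *\<^sub>v v) / s\<^sup>2 \<le> (op_norm M)\<^sup>2"
    using s by (simp add: sqnorm_smult norm_divide power_divide)
  moreover have "0 < sqnorm v" using s by (metis zero_less_power)
  ultimately show ?thesis unfolding s(2) by (simp add: pos_divide_le_eq)
qed

lemma op_norm_le:
  assumes "0 \<le> c" and "\<And>v. v \<in> carrier_vec (dim_col M) \<Longrightarrow> sqnorm (M *\<^sub>v v) \<le> c\<^sup>2 * sqnorm v"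
  shows "op_norm M \<le> c"
  unfolding op_norm_alt
proof (rule cSUP_least)
  show "{v \<in> carrier_vec (dim_col M). sqnorm v \<le> 1} \<noteq> {}"
    by (auto intro!: exI[of _ "0\<^sub>v (dim_col M)"] simp: sqnorm_def)
  fix v assume v: "v \<in> {v \<in> carrier_vec (dim_col M). sqnorm v \<le> 1}"
  then have "sqnorm (M *\<^sub>v v) \<le> c\<^sup>2"
    using assms(2)[of v] mult_left_le[of "sqnorm v" "c\<^sup>2"] by auto
  then show "sqrt (sqnorm (M *\<^sub>v v)) \<le> c" using assms(1) by (simp add: real_le_lsqrt)
qed

text \<open>\<open>M\<close> maps a unit vector to one of its columns. This lower bound certifies
  later that a point lies outside a basic set.\<close>

lemma op_norm_entry:
  assumes "i < dim_row M" "j < dim_col M"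
  shows "cmod (M $$ (i,j)) \<le> op_norm M"
proof -
  have u: "sqnorm (unit_vec (dim_col M) j) = 1"
  proof -
    have "sqnorm (unit_vec (dim_col M) j) = (\<Sum>i<dim_col M. if i = j then 1 else 0)"
      unfolding sqnorm_def by (intro sum.cong) (auto simp: unit_vec_def)
    then show ?thesis using assms by simp
  qed
  have "(cmod (M $$ (i,j)))\<^sup>2 = (cmod (vec_index (M *\<^sub>v unit_vec (dim_col M) j) i))\<^sup>2"
    using assms by (simp add: scalar_prod_right_unit[of j "dim_col M"])
  also have "\<dots> \<le> sqnorm (M *\<^sub>v unit_vec (dim_col M) j)"
    using assms by (intro sqnorm_entry) simp
  also have "\<dots> \<le> (op_norm M)\<^sup>2"
    using op_norm_bound[of "unit_vec (dim_col M) j" M] u by simp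
  finally show ?thesis using op_norm_nonneg by (rule power2_le_imp_le)
qed

section \<open>Block vectors and the action of \<open>mat_fun_eval\<close> on them\<close>

definition block :: "nat \<Rightarrow> complex Matrix.vec \<Rightarrow> nat \<Rightarrow> complex Matrix.vec" where
  "block n v j = Matrix.vec n (\<lambda>b. vec_index v (j * n + b))"

lemma block_carrier [simp]: "block n v j \<in> carrier_vec n" "dim_vec (block n v j) = n"
  by (auto simp: block_def)

lemma sum_blocks:
  fixes g :: "nat \<Rightarrow> 'a::comm_monoid_add"
  shows "(\<Sum>k<r * n. g k) = (\<Sum>j<r. \<Sum>b<n. g (j * n + b))"
proof -
  have "(\<Sum>k<r * n. g k) = (\<Sum>j<r. sum g {j * n..<j * n + n})"
    by (rule sum.nat_group[symmetric])
  also have "\<dots> = (\<Sum>j<r. \<Sum>b<n. g (j * n + b))"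
  proof (rule sum.cong)
    fix j show "sum g {j * n..<j * n + n} = (\<Sum>b<n. g (j * n + b))"
      using sum.shift_bounds_nat_ivl[of g 0 "j * n" n] by (simp add: lessThan_atLeast0 add.commute)
  qed simp
  finally show ?thesis .
qed

lemma sqnorm_blocks: "v \<in> carrier_vec (r * n) \<Longrightarrow> sqnorm v = (\<Sum>j<r. sqnorm (block n v j))"
  by (auto simp: sqnorm_def sum_blocks block_def intro!: sum.cong)

lemma block_index:
  fixes i n a s :: nat
  assumes "i < s" "a < n"
  shows "i * n + a < s * n"
proof -
  have "i * n + a < Suc i * n" using assms by simp
  also have "\<dots> \<le> s * n" using assms by (intro mult_le_mono1) simp
  finally show ?thesis .
qed

definition block_vec :: "nat \<Rightarrow> nat \<Rightarrow> (nat \<Rightarrow> complex Matrix.vec) \<Rightarrow> complex Matrix.vec" where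
  "block_vec r n w = Matrix.vec (r * n) (\<lambda>k. vec_index (w (k div n)) (k mod n))"

lemma block_vec_carrier [simp]: "block_vec r n w \<in> carrier_vec (r * n)"
  by (simp add: block_vec_def)

lemma block_block_vec: "j < r \<Longrightarrow> w j \<in> carrier_vec n \<Longrightarrow> block n (block_vec r n w) j = w j"
  by (auto simp: block_def block_vec_def block_index vec_eq_iff)

lemma mat_fun_eval_dim [simp]:
  "dim_row (mat_fun_eval Q z) = dim_row Q * dim_row z" "dim_col (mat_fun_eval Q z) = dim_col Q * dim_row z"
  by (auto simp: mat_fun_eval_def Let_def)

text \<open>Block matrix times block vector. The sum over \<open>j\<close> is taken coordinatewise
  since vectors of all lengths together form no additive monoid.\<close>

lemma block_mat_fun_eval:
  assumes v: "v \<in> carrier_vec (dim_col Q * n)" and z: "dim_row z = n" and i: "i < dim_row Q"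
    and Q: "\<And>j. j < dim_col Q \<Longrightarrow> (Q $$ (i,j)) z \<in> carrier_mat n n"
  shows "block n (mat_fun_eval Q z *\<^sub>v v) i =
    Matrix.vec n (\<lambda>a. \<Sum>j<dim_col Q. vec_index ((Q $$ (i,j)) z *\<^sub>v block n v j) a)"
proof (rule eq_vecI)
  fix a assume "a < dim_vec (Matrix.vec n (\<lambda>a. \<Sum>j<dim_col Q. vec_index ((Q $$ (i,j)) z *\<^sub>v block n v j) a))"
  then have a: "a < n" by simp
  have "vec_index (mat_fun_eval Q z *\<^sub>v v) (i * n + a) =
      (\<Sum>k<dim_col Q * n. mat_fun_eval Q z $$ (i * n + a, k) * vec_index v k)"
    using v z block_index[OF i a] by (intro mult_mat_vec_entry) (auto intro!: carrier_matI)
  also have "\<dots> = (\<Sum>j<dim_col Q. \<Sum>b<n. mat_fun_eval Q z $$ (i * n + a, j * n + b) * vec_index v (j * n + b))"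
    by (rule sum_blocks)
  also have "\<dots> = (\<Sum>j<dim_col Q. vec_index ((Q $$ (i,j)) z *\<^sub>v block n v j) a)"
  proof (rule sum.cong)
    fix j assume j: "j \<in> {..<dim_col Q}"
    then show "(\<Sum>b<n. mat_fun_eval Q z $$ (i * n + a, j * n + b) * vec_index v (j * n + b)) =
        vec_index ((Q $$ (i,j)) z *\<^sub>v block n v j) a"
      using i a z block_index[OF i a] block_index[of j "dim_col Q" _ n]
      by (subst mult_mat_vec_entry[OF Q]) (auto simp: mat_fun_eval_def Let_def block_def intro!: sum.cong)
  qed simp
  finally show "vec_index (block n (mat_fun_eval Q z *\<^sub>v v) i) a =
      vec_index (Matrix.vec n (\<lambda>a. \<Sum>j<dim_col Q. vec_index ((Q $$ (i,j)) z *\<^sub>v block n v j) a)) a"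
    using a by (simp add: block_def)
qed simp

lemma mult_mat_vec_sum:
  assumes "C \<in> carrier_mat m n" "\<And>j. j < r \<Longrightarrow> u j \<in> carrier_vec n"
  shows "C *\<^sub>v Matrix.vec n (\<lambda>a. \<Sum>j<r. vec_index (u j) a) =
    Matrix.vec m (\<lambda>a. \<Sum>j<r. vec_index (C *\<^sub>v u j) a)"
proof (rule eq_vecI)
  fix i assume "i < dim_vec (Matrix.vec m (\<lambda>a. \<Sum>j<r. vec_index (C *\<^sub>v u j) a))"
  then have i: "i < m" by simp
  have "vec_index (C *\<^sub>v Matrix.vec n (\<lambda>a. \<Sum>j<r. vec_index (u j) a)) i =
      (\<Sum>k<n. \<Sum>j<r. C $$ (i,k) * vec_index (u j) k)"
    using assms i by (subst mult_mat_vec_entry[of C m n]) (auto simp: sum_distrib_left)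
  also have "\<dots> = (\<Sum>j<r. \<Sum>k<n. C $$ (i,k) * vec_index (u j) k)" by (rule sum.swap)
  also have "\<dots> = (\<Sum>j<r. vec_index (C *\<^sub>v u j) i)"
    using assms i by (intro sum.cong) (auto simp: mult_mat_vec_entry[of C m n] simp del: index_mult_mat_vec)
  finally show "vec_index (C *\<^sub>v Matrix.vec n (\<lambda>a. \<Sum>j<r. vec_index (u j) a)) i =
      vec_index (Matrix.vec m (\<lambda>a. \<Sum>j<r. vec_index (C *\<^sub>v u j) a)) i" using i by simp
qed (use assms in auto)

text \<open>
  Matrix convexity of the open unit ball: the hypotheses on \<open>R\<^sub>1, R\<^sub>2\<close> and on \<open>C\<^sub>1, C\<^sub>2\<close> say that the
  column \<open>[R\<^sub>1; R\<^sub>2]\<close> and the row \<open>[C\<^sub>1, C\<^sub>2]\<close> are contractions. Direct sums, direct summands and convex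
  combinations with a unitary conjugate are all of this form.
\<close>
lemma op_norm_mat_fun_eval_convex:
  assumes lt: "op_norm (mat_fun_eval Q z1) < 1" "op_norm (mat_fun_eval Q z2) < 1"
    and dims: "dim_row z = n" "dim_row z1 = n1" "dim_row z2 = n2"
    and C: "C1 \<in> carrier_mat n n1" "C2 \<in> carrier_mat n n2"
    and R: "R1 \<in> carrier_mat n1 n" "R2 \<in> carrier_mat n2 n"
    and Q1: "\<And>q. q \<in> elements_mat Q \<Longrightarrow> q z1 \<in> carrier_mat n1 n1"
    and Q2: "\<And>q. q \<in> elements_mat Q \<Longrightarrow> q z2 \<in> carrier_mat n2 n2"
    and Qz: "\<And>q. q \<in> elements_mat Q \<Longrightarrow> q z = C1 * q z1 * R1 + C2 * q z2 * R2"
    and Rc: "\<And>w. w \<in> carrier_vec n \<Longrightarrow> sqnorm (R1 *\<^sub>v w) + sqnorm (R2 *\<^sub>v w) \<le> sqnorm w"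
    and Cc: "\<And>u1 u2. u1 \<in> carrier_vec n1 \<Longrightarrow> u2 \<in> carrier_vec n2 \<Longrightarrow>
      sqnorm (C1 *\<^sub>v u1 + C2 *\<^sub>v u2) \<le> sqnorm u1 + sqnorm u2"
  shows "op_norm (mat_fun_eval Q z) < 1"
proof -
  \<comment> \<open>A common bound that is still below 1: the estimate below yields norm at most
    \<open>c\<close>, which preserves strictness.\<close>
  define c where "c = max (op_norm (mat_fun_eval Q z1)) (op_norm (mat_fun_eval Q z2))"
  have c: "0 \<le> c" "c < 1" using lt op_norm_nonneg by (auto simp: c_def le_max_iff_disj)
  let ?s = "dim_row Q" and ?r = "dim_col Q"
  have el: "Q $$ (i,j) \<in> elements_mat Q" if "i < ?s" "j < ?r" for i j
    using that by (auto simp: elements_mat_def intro!: bexI[of _ i])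
  have bound: "sqnorm (mat_fun_eval Q y *\<^sub>v v) \<le> c\<^sup>2 * sqnorm v"
    if "op_norm (mat_fun_eval Q y) \<le> c" "v \<in> carrier_vec (?r * dim_row y)" for y v
  proof -
    have "sqnorm (mat_fun_eval Q y *\<^sub>v v) \<le> (op_norm (mat_fun_eval Q y))\<^sup>2 * sqnorm v"
      using that by (intro op_norm_bound) simp
    also have "\<dots> \<le> c\<^sup>2 * sqnorm v"
      using that op_norm_nonneg by (intro mult_right_mono power_mono) auto
    finally show ?thesis .
  qed
  have "op_norm (mat_fun_eval Q z) \<le> c"
  proof (rule op_norm_le[OF c(1)])
    fix v :: "complex Matrix.vec" assume "v \<in> carrier_vec (dim_col (mat_fun_eval Q z))"
    then have v: "v \<in> carrier_vec (?r * n)" using dims by simp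
    \<comment> \<open>\<open>R1\<close> and \<open>R2\<close> act on each block of \<open>v\<close>
      separately. Then \<open>Q(z) v\<close> is obtained from \<open>Q(z1) v1\<close> and
      \<open>Q(z2) v2\<close> by applying \<open>C1\<close> and \<open>C2\<close> blockwise and
      adding, which is \<open>yb\<close> below.\<close>
    define v1 where "v1 = block_vec ?r n1 (\<lambda>j. R1 *\<^sub>v block n v j)"
    define v2 where "v2 = block_vec ?r n2 (\<lambda>j. R2 *\<^sub>v block n v j)"
    have b1: "block n1 v1 j = R1 *\<^sub>v block n v j" if "j < ?r" for j
      unfolding v1_def by (rule block_block_vec[OF that mult_mat_vec_carrier[OF R(1) block_carrier(1)]])
    have b2: "block n2 v2 j = R2 *\<^sub>v block n v j" if "j < ?r" for j
      unfolding v2_def by (rule block_block_vec[OF that mult_mat_vec_carrier[OF R(2) block_carrier(1)]])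
    have car: "v1 \<in> carrier_vec (?r * n1)" "v2 \<in> carrier_vec (?r * n2)" by (auto simp: v1_def v2_def)
    define y where "y = mat_fun_eval Q z *\<^sub>v v"
    define y1 where "y1 = mat_fun_eval Q z1 *\<^sub>v v1"
    define y2 where "y2 = mat_fun_eval Q z2 *\<^sub>v v2"
    have ycar: "y \<in> carrier_vec (?s * n)" "y1 \<in> carrier_vec (?s * n1)" "y2 \<in> carrier_vec (?s * n2)"
      using dims by (auto simp: y_def y1_def y2_def intro!: carrier_vecI)
    have yb: "block n y i = C1 *\<^sub>v block n1 y1 i + C2 *\<^sub>v block n2 y2 i" if i: "i < ?s" for i
    proof -
      have q: "(Q $$ (i,j)) z *\<^sub>v w = C1 *\<^sub>v ((Q $$ (i,j)) z1 *\<^sub>v (R1 *\<^sub>v w)) + C2 *\<^sub>v ((Q $$ (i,j)) z2 *\<^sub>v (R2 *\<^sub>v w))"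
        and qc: "(Q $$ (i,j)) z \<in> carrier_mat n n"
        if j: "j < ?r" and w: "w \<in> carrier_vec n" for j w
      proof -
        note q1 = Q1[OF el[OF i j]] and q2 = Q2[OF el[OF i j]]
        have c12: "C1 * (Q $$ (i,j)) z1 \<in> carrier_mat n n1" "C2 * (Q $$ (i,j)) z2 \<in> carrier_mat n n2"
          using C q1 q2 by auto
        then have c12': "C1 * (Q $$ (i,j)) z1 * R1 \<in> carrier_mat n n" "C2 * (Q $$ (i,j)) z2 * R2 \<in> carrier_mat n n"
          using R by auto
        show "(Q $$ (i,j)) z \<in> carrier_mat n n" unfolding Qz[OF el[OF i j]] using c12' by auto
        have R': "R1 *\<^sub>v w \<in> carrier_vec n1" "R2 *\<^sub>v w \<in> carrier_vec n2"
          using mult_mat_vec_carrier[OF R(1) w] mult_mat_vec_carrier[OF R(2) w] .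
        show "(Q $$ (i,j)) z *\<^sub>v w = C1 *\<^sub>v ((Q $$ (i,j)) z1 *\<^sub>v (R1 *\<^sub>v w)) + C2 *\<^sub>v ((Q $$ (i,j)) z2 *\<^sub>v (R2 *\<^sub>v w))"
          unfolding Qz[OF el[OF i j]] add_mult_distrib_mat_vec[OF c12' w]
            assoc_mult_mat_vec[OF c12(1) R(1) w] assoc_mult_mat_vec[OF c12(2) R(2) w]
            assoc_mult_mat_vec[OF C(1) q1 R'(1)] assoc_mult_mat_vec[OF C(2) q2 R'(2)] ..
      qed
      have k1: "C1 *\<^sub>v block n1 y1 i = Matrix.vec n (\<lambda>a. \<Sum>j<?r. vec_index (C1 *\<^sub>v ((Q $$ (i,j)) z1 *\<^sub>v (R1 *\<^sub>v block n v j))) a)"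
      proof -
        have "block n1 y1 i = Matrix.vec n1 (\<lambda>a. \<Sum>j<?r. vec_index ((Q $$ (i,j)) z1 *\<^sub>v block n1 v1 j) a)"
          unfolding y1_def using car dims i Q1 el by (intro block_mat_fun_eval) auto
        also have "\<dots> = Matrix.vec n1 (\<lambda>a. \<Sum>j<?r. vec_index ((Q $$ (i,j)) z1 *\<^sub>v (R1 *\<^sub>v block n v j)) a)"
          by (simp add: b1)
        finally have e: "block n1 y1 i =
            Matrix.vec n1 (\<lambda>a. \<Sum>j<?r. vec_index ((Q $$ (i,j)) z1 *\<^sub>v (R1 *\<^sub>v block n v j)) a)" .
        have "(Q $$ (i,j)) z1 *\<^sub>v (R1 *\<^sub>v block n v j) \<in> carrier_vec n1" if "j < ?r" for j
          by (rule mult_mat_vec_carrier[OF Q1[OF el[OF i that]] mult_mat_vec_carrier[OF R(1) block_carrier(1)]])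
        then show ?thesis
          unfolding e by (rule mult_mat_vec_sum[OF C(1)])
      qed
      have k2: "C2 *\<^sub>v block n2 y2 i = Matrix.vec n (\<lambda>a. \<Sum>j<?r. vec_index (C2 *\<^sub>v ((Q $$ (i,j)) z2 *\<^sub>v (R2 *\<^sub>v block n v j))) a)"
      proof -
        have "block n2 y2 i = Matrix.vec n2 (\<lambda>a. \<Sum>j<?r. vec_index ((Q $$ (i,j)) z2 *\<^sub>v block n2 v2 j) a)"
          unfolding y2_def using car dims i Q2 el by (intro block_mat_fun_eval) auto
        also have "\<dots> = Matrix.vec n2 (\<lambda>a. \<Sum>j<?r. vec_index ((Q $$ (i,j)) z2 *\<^sub>v (R2 *\<^sub>v block n v j)) a)"
          by (simp add: b2)
        finally have e: "block n2 y2 i =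
            Matrix.vec n2 (\<lambda>a. \<Sum>j<?r. vec_index ((Q $$ (i,j)) z2 *\<^sub>v (R2 *\<^sub>v block n v j)) a)" .
        have "(Q $$ (i,j)) z2 *\<^sub>v (R2 *\<^sub>v block n v j) \<in> carrier_vec n2" if "j < ?r" for j
          by (rule mult_mat_vec_carrier[OF Q2[OF el[OF i that]] mult_mat_vec_carrier[OF R(2) block_carrier(1)]])
        then show ?thesis
          unfolding e by (rule mult_mat_vec_sum[OF C(2)])
      qed
      have "block n y i = Matrix.vec n (\<lambda>a. \<Sum>j<?r. vec_index ((Q $$ (i,j)) z *\<^sub>v block n v j) a)"
        unfolding y_def using v dims i qc[of _ "0\<^sub>v n"] by (intro block_mat_fun_eval) auto
      also have "\<dots> = C1 *\<^sub>v block n1 y1 i + C2 *\<^sub>v block n2 y2 i"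
        unfolding k1 k2 using C
        by (intro eq_vecI) (auto simp: q sum.distrib simp del: index_mult_mat_vec intro!: sum.cong)
      finally show ?thesis .
    qed
    \<comment> \<open>The row contraction splits \<open>y\<close> into \<open>y1\<close> and
      \<open>y2\<close>, the norms of \<open>Q(z1)\<close> and \<open>Q(z2)\<close> contribute the
      factor \<open>c\<close> squared, and the column contraction recombines \<open>v1\<close> and
      \<open>v2\<close> into \<open>v\<close>.\<close>
    have "sqnorm y = (\<Sum>i<?s. sqnorm (C1 *\<^sub>v block n1 y1 i + C2 *\<^sub>v block n2 y2 i))"
      unfolding sqnorm_blocks[OF ycar(1)] by (simp add: yb)
    also have "\<dots> \<le> (\<Sum>i<?s. sqnorm (block n1 y1 i) + sqnorm (block n2 y2 i))"
      by (intro sum_mono Cc) auto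
    also have "\<dots> = sqnorm y1 + sqnorm y2"
      by (simp add: sqnorm_blocks[OF ycar(2)] sqnorm_blocks[OF ycar(3)] sum.distrib)
    also have "\<dots> \<le> c\<^sup>2 * sqnorm v1 + c\<^sup>2 * sqnorm v2"
      unfolding y1_def y2_def using car dims by (intro add_mono bound) (auto simp: c_def)
    also have "\<dots> = c\<^sup>2 * (\<Sum>j<?r. sqnorm (R1 *\<^sub>v block n v j) + sqnorm (R2 *\<^sub>v block n v j))"
      by (simp add: sqnorm_blocks[OF car(1)] sqnorm_blocks[OF car(2)] b1 b2 sum.distrib distrib_left)
    also have "\<dots> \<le> c\<^sup>2 * (\<Sum>j<?r. sqnorm (block n v j))"
      by (intro mult_left_mono sum_mono Rc) auto
    also have "\<dots> = c\<^sup>2 * sqnorm v" by (simp add: sqnorm_blocks[OF v])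
    finally show "sqnorm (mat_fun_eval Q z *\<^sub>v v) \<le> c\<^sup>2 * sqnorm v" by (simp add: y_def)
  qed
  then show ?thesis using c by simp
qed

section \<open>Orthogonal projections\<close>

lemma complex_mult_cnj_norm: "x * cnj x = complex_of_real ((cmod x)\<^sup>2)"
  by (simp add: complex_norm_square[symmetric])

definition hermitian :: "nat \<Rightarrow> complex mat \<Rightarrow> bool" where
  "hermitian n H \<longleftrightarrow> H \<in> carrier_mat n n \<and> (\<forall>i<n. \<forall>j<n. H $$ (i,j) = cnj (H $$ (j,i)))"

lemma hermitianD: "hermitian n H \<Longrightarrow> i < n \<Longrightarrow> j < n \<Longrightarrow> H $$ (i,j) = cnj (H $$ (j,i))"
  unfolding hermitian_def by blast

lemma hermitian_cinner:
  assumes H: "hermitian n H" and v: "v \<in> carrier_vec n" and w: "w \<in> carrier_vec n"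
  shows "(\<Sum>i<n. vec_index (H *\<^sub>v v) i * cnj (vec_index w i)) =
    (\<Sum>i<n. vec_index v i * cnj (vec_index (H *\<^sub>v w) i))"
proof -
  have c: "H \<in> carrier_mat n n" using H by (simp add: hermitian_def)
  have "(\<Sum>i<n. vec_index (H *\<^sub>v v) i * cnj (vec_index w i)) =
      (\<Sum>i<n. \<Sum>k<n. H $$ (i,k) * vec_index v k * cnj (vec_index w i))"
    by (intro sum.cong) (auto simp: mult_mat_vec_entry[OF c v] sum_distrib_right simp del: index_mult_mat_vec)
  also have "\<dots> = (\<Sum>k<n. \<Sum>i<n. H $$ (i,k) * vec_index v k * cnj (vec_index w i))" by (rule sum.swap)
  also have "\<dots> = (\<Sum>k<n. vec_index v k * cnj (vec_index (H *\<^sub>v w) k))"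
  proof (rule sum.cong)
    fix k assume k: "k \<in> {..<n}"
    have "H $$ (i,k) = cnj (H $$ (k,i))" if "i < n" for i
      using H that k by (intro hermitianD) auto
    then show "(\<Sum>i<n. H $$ (i,k) * vec_index v k * cnj (vec_index w i)) = vec_index v k * cnj (vec_index (H *\<^sub>v w) k)"
      using k by (auto simp: mult_mat_vec_entry[OF c w] sum_distrib_left simp del: index_mult_mat_vec intro!: sum.cong)
  qed simp
  finally show ?thesis .
qed

lemma sqnorm_cinner: "v \<in> carrier_vec n \<Longrightarrow> complex_of_real (sqnorm v) = (\<Sum>i<n. vec_index v i * cnj (vec_index v i))"
  by (auto simp: sqnorm_def complex_mult_cnj_norm)

text \<open>A self-adjoint involution is unitary: the inner product of \<open>H v\<close> with
  itself is that of \<open>v\<close> with \<open>H (H v) = v\<close>.\<close>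

lemma sqnorm_hermitian_involution:
  assumes H: "hermitian n H" "H * H = 1\<^sub>m n" and v: "v \<in> carrier_vec n"
  shows "sqnorm (H *\<^sub>v v) = sqnorm v"
proof -
  have c: "H \<in> carrier_mat n n" using H by (simp add: hermitian_def)
  have Hv: "H *\<^sub>v v \<in> carrier_vec n" using c v by auto
  have "H *\<^sub>v (H *\<^sub>v v) = v" using assoc_mult_mat_vec[OF c c v] H v by simp
  then have "complex_of_real (sqnorm (H *\<^sub>v v)) = complex_of_real (sqnorm v)"
    unfolding sqnorm_cinner[OF Hv] sqnorm_cinner[OF v] using hermitian_cinner[OF H(1) v Hv] by simp
  then show ?thesis by simp
qed

definition orth_proj :: "nat \<Rightarrow> complex mat \<Rightarrow> bool" where
  "orth_proj n P \<longleftrightarrow> hermitian n P \<and> P * P = P"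

lemma orth_proj_carrier: "orth_proj n P \<Longrightarrow> P \<in> carrier_mat n n"
  by (simp add: orth_proj_def hermitian_def)

text \<open>A diagonal entry of a Hermitian idempotent is the squared norm of its row, hence at
  least its own square. Summed over the diagonal, this bounds the trace by \<open>n\<close>.\<close>

lemma orth_proj_diag_le_1:
  assumes P: "orth_proj n P" and i: "i < n"
  shows "Re (P $$ (i,i)) \<le> 1"
proof -
  note c = orth_proj_carrier[OF P]
  have "P $$ (i,i) = (P * P) $$ (i,i)" using P by (simp add: orth_proj_def)
  also have "\<dots> = (\<Sum>k<n. P $$ (i,k) * P $$ (k,i))" using c i by (intro mult_mat_entry)
  also have "\<dots> = (\<Sum>k<n. complex_of_real ((cmod (P $$ (i,k)))\<^sup>2))"
  proof (rule sum.cong)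
    fix k assume "k \<in> {..<n}"
    then have "P $$ (k,i) = cnj (P $$ (i,k))" using P i by (intro hermitianD) (auto simp: orth_proj_def)
    then show "P $$ (i,k) * P $$ (k,i) = complex_of_real ((cmod (P $$ (i,k)))\<^sup>2)"
      by (simp add: complex_mult_cnj_norm)
  qed simp
  finally have "Re (P $$ (i,i)) = (\<Sum>k<n. (cmod (P $$ (i,k)))\<^sup>2)" by (simp add: of_real_sum[symmetric] del: of_real_sum)
  also have "\<dots> \<ge> (cmod (P $$ (i,i)))\<^sup>2" using i by (intro member_le_sum) auto
  finally have "(Re (P $$ (i,i)))\<^sup>2 \<le> Re (P $$ (i,i))"
    using power_mono[OF abs_Re_le_cmod[of "P $$ (i,i)"], of 2] by simp
  then show ?thesis by (smt (verit) power2_eq_square mult_left_le_imp_le mult_le_cancel_left1)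
qed

text \<open>\<open>P u = 0\<close> says that \<open>u\<close> is orthogonal to the range of
  \<open>P\<close>. The rank-one projection \<open>u u^* / |u|^2\<close> therefore has zero product
  with \<open>P\<close> on both sides and can be added to it; its trace is 1.\<close>

lemma orth_proj_extend:
  assumes P: "orth_proj n P" and u: "u \<in> carrier_vec n" "P *\<^sub>v u = 0\<^sub>v n" "u \<noteq> 0\<^sub>v n"
  obtains P' where "orth_proj n P'" "(\<Sum>i<n. P' $$ (i,i)) = (\<Sum>i<n. P $$ (i,i)) + 1"
    "\<And>w. w \<in> carrier_vec n \<Longrightarrow> \<exists>a. P' *\<^sub>v w = P *\<^sub>v w + a \<cdot>\<^sub>v u"
proof
  note c = orth_proj_carrier[OF P]
  define s where "s = complex_of_real (sqnorm u)"
  have s0: "s \<noteq> 0" using u by (auto simp: s_def sqnorm_eq_0)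
  have s: "(\<Sum>k<n. vec_index u k * cnj (vec_index u k)) = s"
    unfolding s_def by (rule sqnorm_cinner[OF u(1), symmetric])
  define R where "R = mat n n (\<lambda>(i,j). vec_index u i * cnj (vec_index u j) / s)"
  have Rc: "R \<in> carrier_mat n n" by (simp add: R_def)
  have Pu: "(\<Sum>k<n. P $$ (i,k) * vec_index u k) = 0" if "i < n" for i
    using mult_mat_vec_entry[OF c u(1) that] u(2) that by simp
  have PR: "P * R = 0\<^sub>m n n"
  proof (rule eq_matI)
    fix i j assume "i < dim_row (0\<^sub>m n n :: complex mat)" "j < dim_col (0\<^sub>m n n :: complex mat)"
    then have ij: "i < n" "j < n" by auto
    have "(P * R) $$ (i,j) = (\<Sum>k<n. (P $$ (i,k) * vec_index u k) * (cnj (vec_index u j) / s))"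
      unfolding mult_mat_entry[OF c Rc ij] using ij by (intro sum.cong) (auto simp: R_def)
    also have "\<dots> = 0" unfolding sum_distrib_right[symmetric] using Pu ij by simp
    finally show "(P * R) $$ (i,j) = 0\<^sub>m n n $$ (i,j)" using ij by simp
  qed (use c Rc in auto)
  have RP: "R * P = 0\<^sub>m n n"
  proof (rule eq_matI)
    fix i j assume "i < dim_row (0\<^sub>m n n :: complex mat)" "j < dim_col (0\<^sub>m n n :: complex mat)"
    then have ij: "i < n" "j < n" by auto
    have h: "P $$ (k,j) = cnj (P $$ (j,k))" if "k < n" for k
      using P ij that by (intro hermitianD) (auto simp: orth_proj_def)
    have "(R * P) $$ (i,j) = (\<Sum>k<n. (vec_index u i / s) * cnj (P $$ (j,k) * vec_index u k))"
      unfolding mult_mat_entry[OF Rc c ij] using ij by (intro sum.cong) (auto simp: R_def h)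
    also have "\<dots> = (vec_index u i / s) * cnj (\<Sum>k<n. P $$ (j,k) * vec_index u k)"
      unfolding cnj_sum sum_distrib_left ..
    also have "\<dots> = 0" using Pu ij by simp
    finally show "(R * P) $$ (i,j) = 0\<^sub>m n n $$ (i,j)" using ij by simp
  qed (use c Rc in auto)
  have RR: "R * R = R"
  proof (rule eq_matI)
    fix i j assume "i < dim_row R" "j < dim_col R"
    then have ij: "i < n" "j < n" by (auto simp: R_def)
    have "(R * R) $$ (i,j) = (\<Sum>k<n. (vec_index u i * cnj (vec_index u j) / (s * s)) * (vec_index u k * cnj (vec_index u k)))"
      unfolding mult_mat_entry[OF Rc Rc ij] using ij by (intro sum.cong) (auto simp: R_def)
    also have "\<dots> = R $$ (i,j)"
      unfolding sum_distrib_left[symmetric] s using ij s0 by (simp add: R_def)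
    finally show "(R * R) $$ (i,j) = R $$ (i,j)" .
  qed (use Rc in auto)
  show "orth_proj n (P + R)"
    unfolding orth_proj_def
  proof
    have "(P + R) $$ (i,j) = cnj ((P + R) $$ (j,i))" if ij: "i < n" "j < n" for i j
    proof -
      have "P $$ (i,j) = cnj (P $$ (j,i))" using P ij by (intro hermitianD) (auto simp: orth_proj_def)
      moreover have "R $$ (i,j) = cnj (R $$ (j,i))" using ij by (simp add: R_def s_def)
      ultimately show ?thesis using c Rc ij by simp
    qed
    then show "hermitian n (P + R)" using c Rc by (simp add: hermitian_def)
    have "(P + R) * (P + R) = P * (P + R) + R * (P + R)"
      using c Rc by (intro add_mult_distrib_mat) auto
    also have "P * (P + R) = P * P + P * R" using c Rc by (intro mult_add_distrib_mat) auto
    also have "R * (P + R) = R * P + R * R" using c Rc by (intro mult_add_distrib_mat) auto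
    finally have "(P + R) * (P + R) = P * P + P * R + (R * P + R * R)" .
    then show "(P + R) * (P + R) = P + R"
      using P c Rc unfolding PR RP RR by (simp add: orth_proj_def)
  qed
  have "(\<Sum>i<n. (P + R) $$ (i,i)) = (\<Sum>i<n. P $$ (i,i) + vec_index u i * cnj (vec_index u i) / s)"
    using c Rc by (intro sum.cong) (auto simp: R_def)
  also have "\<dots> = (\<Sum>i<n. P $$ (i,i)) + 1"
    unfolding sum.distrib sum_divide_distrib[symmetric] s using s0 by simp
  finally show "(\<Sum>i<n. (P + R) $$ (i,i)) = (\<Sum>i<n. P $$ (i,i)) + 1" .
  fix w :: "complex Matrix.vec" assume w: "w \<in> carrier_vec n"
  have "R *\<^sub>v w = ((\<Sum>k<n. cnj (vec_index u k) * vec_index w k) / s) \<cdot>\<^sub>v u"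
  proof (rule eq_vecI)
    fix i assume "i < dim_vec (((\<Sum>k<n. cnj (vec_index u k) * vec_index w k) / s) \<cdot>\<^sub>v u)"
    then have i: "i < n" using u by simp
    have "vec_index (R *\<^sub>v w) i = (\<Sum>k<n. (cnj (vec_index u k) * vec_index w k) * (vec_index u i / s))"
      unfolding mult_mat_vec_entry[OF Rc w i] using i by (intro sum.cong) (auto simp: R_def)
    also have "\<dots> = vec_index (((\<Sum>k<n. cnj (vec_index u k) * vec_index w k) / s) \<cdot>\<^sub>v u) i"
      unfolding sum_distrib_right[symmetric] using i u by simp
    finally show "vec_index (R *\<^sub>v w) i = vec_index (((\<Sum>k<n. cnj (vec_index u k) * vec_index w k) / s) \<cdot>\<^sub>v u) i" .
  qed (use Rc u in auto)
  then show "\<exists>a. (P + R) *\<^sub>v w = P *\<^sub>v w + a \<cdot>\<^sub>v u"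
    using add_mult_distrib_mat_vec[OF c Rc w] by auto
qed

text \<open>The trace plays the role of the dimension, so no basis of \<open>M\<close> is needed:
  take a projection with range inside \<open>M\<close> whose trace is the largest possible natural
  number. If it moved some \<open>v\<close> in \<open>M\<close>, the residual \<open>v - P v\<close>
  would be a nonzero vector of \<open>M\<close> killed by \<open>P\<close>, and adding its rank-one
  projection would raise the trace by 1.\<close>

lemma orth_proj_exists:
  assumes M: "M \<subseteq> carrier_vec n" "0\<^sub>v n \<in> M"
    and add: "\<And>u v. u \<in> M \<Longrightarrow> v \<in> M \<Longrightarrow> u + v \<in> M"
    and smult: "\<And>a v. v \<in> M \<Longrightarrow> a \<cdot>\<^sub>v v \<in> M"
  obtains P where "orth_proj n P" "\<And>v. v \<in> carrier_vec n \<Longrightarrow> P *\<^sub>v v \<in> M" "\<And>v. v \<in> M \<Longrightarrow> P *\<^sub>v v = v"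
proof -
  define T where "T k P \<longleftrightarrow> orth_proj n P \<and> (\<forall>v\<in>carrier_vec n. P *\<^sub>v v \<in> M) \<and> (\<Sum>i<n. P $$ (i,i)) = of_nat k" for k P
  have "0\<^sub>m n n *\<^sub>v v = 0\<^sub>v n" if "v \<in> carrier_vec n" for v :: "complex Matrix.vec"
    using that by (intro eq_vecI) auto
  then have T0: "T 0 (0\<^sub>m n n)"
    using M(2) by (auto simp: T_def orth_proj_def hermitian_def)
  have le: "k \<le> n" if "T k P" for k P
  proof -
    have "real k = Re (\<Sum>i<n. P $$ (i,i))" using that by (simp add: T_def)
    also have "\<dots> \<le> (\<Sum>i<n. 1)"
      unfolding Re_sum using that by (intro sum_mono orth_proj_diag_le_1) (auto simp: T_def)
    finally show ?thesis by simp
  qed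
  define k where "k = (GREATEST k. \<exists>P. T k P)"
  have "\<exists>P. T k P" unfolding k_def
    by (rule GreatestI_nat[of "\<lambda>k. \<exists>P. T k P" 0 n]) (use T0 le in auto)
  then obtain P where P: "T k P" by blast
  have max: "\<not> T (Suc k) P'" for P'
  proof
    assume "T (Suc k) P'"
    then have "Suc k \<le> k" unfolding k_def
      by (intro Greatest_le_nat[of "\<lambda>k. \<exists>P. T k P" _ n]) (use le k_def in auto)
    then show False by simp
  qed
  have op: "orth_proj n P" and PM: "\<And>v. v \<in> carrier_vec n \<Longrightarrow> P *\<^sub>v v \<in> M" using P by (auto simp: T_def)
  note c = orth_proj_carrier[OF op]
  have "P *\<^sub>v v = v" if v: "v \<in> M" for v
  proof (rule ccontr)
    assume ne: "P *\<^sub>v v \<noteq> v"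
    have vc: "v \<in> carrier_vec n" "P *\<^sub>v v \<in> carrier_vec n" using v M c by auto
    define u where "u = v + (-1) \<cdot>\<^sub>v (P *\<^sub>v v)"
    have uM: "u \<in> M" unfolding u_def using v PM vc by (intro add smult) auto
    then have uc: "u \<in> carrier_vec n" using M by auto
    have "P *\<^sub>v (P *\<^sub>v v) = P *\<^sub>v v"
      using assoc_mult_mat_vec[OF c c vc(1)] op by (simp add: orth_proj_def)
    then have "P *\<^sub>v u = P *\<^sub>v v + (-1) \<cdot>\<^sub>v (P *\<^sub>v v)"
      unfolding u_def using mult_add_distrib_mat_vec[OF c vc(1), of "(-1) \<cdot>\<^sub>v (P *\<^sub>v v)"] mult_mat_vec[OF c vc(2), of "-1"] vc by simp
    also have "\<dots> = 0\<^sub>v n" using vc c by (intro eq_vecI) (auto simp del: index_mult_mat_vec)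
    finally have Pu: "P *\<^sub>v u = 0\<^sub>v n" .
    have "u \<noteq> 0\<^sub>v n"
    proof
      assume u0: "u = 0\<^sub>v n"
      have "P *\<^sub>v v = v"
      proof (rule eq_vecI)
        fix i assume i: "i < dim_vec v"
        then have "vec_index u i = vec_index v i - vec_index (P *\<^sub>v v) i"
          unfolding u_def using vc c by (simp del: index_mult_mat_vec)
        then show "vec_index (P *\<^sub>v v) i = vec_index v i" using u0 i vc by simp
      qed (use vc c in auto)
      then show False using ne by simp
    qed
    then obtain P' where P': "orth_proj n P'" "(\<Sum>i<n. P' $$ (i,i)) = (\<Sum>i<n. P $$ (i,i)) + 1"
      "\<And>w. w \<in> carrier_vec n \<Longrightarrow> \<exists>a. P' *\<^sub>v w = P *\<^sub>v w + a \<cdot>\<^sub>v u"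
      using orth_proj_extend[OF op uc Pu] by blast
    have "P' *\<^sub>v w \<in> M" if "w \<in> carrier_vec n" for w
      using P'(3)[OF that] PM[OF that] uM add smult by fastforce
    then have "T (Suc k) P'" using P' P by (auto simp: T_def)
    then show False using max by blast
  qed
  with op PM show ?thesis using that by blast
qed

section \<open>Basic free open sets\<close>

lemma sum_lessThan_add:
  fixes g :: "nat \<Rightarrow> 'a::comm_monoid_add"
  shows "(\<Sum>i<n + m. g i) = (\<Sum>i<n. g i) + (\<Sum>i<m. g (n + i))"
  by (induction m) (auto simp: add.assoc)

lemma proj1_vec: "w \<in> carrier_vec (n + m) \<Longrightarrow> proj1 n m *\<^sub>v w = Matrix.vec n (\<lambda>i. vec_index w i)"
  by (intro eq_vecI)
    (auto simp: mult_mat_vec_entry[of _ n "n + m"] proj1_def if_mult simp del: index_mult_mat_vec)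

lemma proj2_vec: "w \<in> carrier_vec (n + m) \<Longrightarrow> proj2 n m *\<^sub>v w = Matrix.vec m (\<lambda>i. vec_index w (n + i))"
  by (intro eq_vecI)
    (auto simp: mult_mat_vec_entry[of _ m "n + m"] proj2_def if_mult simp del: index_mult_mat_vec)

lemma sqnorm_proj:
  assumes "w \<in> carrier_vec (n + m)"
  shows "sqnorm (proj1 n m *\<^sub>v w) + sqnorm (proj2 n m *\<^sub>v w) = sqnorm w"
  using assms by (simp add: proj1_vec proj2_vec sqnorm_def sum_lessThan_add)

lemma incl_vec:
  assumes u: "u \<in> carrier_vec n" and w: "w \<in> carrier_vec m"
  shows "incl1 n m *\<^sub>v u + incl2 n m *\<^sub>v w = u @\<^sub>v w"
proof -
  let ?a = "u @\<^sub>v w"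
  have a: "?a \<in> carrier_vec (n + m)" using u w by simp
  have p: "proj1 n m *\<^sub>v ?a = u" "proj2 n m *\<^sub>v ?a = w"
    using u w by (auto simp: proj1_vec[OF a] proj2_vec[OF a] intro!: eq_vecI)
  have "?a = (incl1 n m * proj1 n m + incl2 n m * proj2 n m) *\<^sub>v ?a"
    using a by (simp add: incl_proj)
  also have "\<dots> = (incl1 n m * proj1 n m) *\<^sub>v ?a + (incl2 n m * proj2 n m) *\<^sub>v ?a"
    using a by (intro add_mult_distrib_mat_vec) auto
  also have "(incl1 n m * proj1 n m) *\<^sub>v ?a = incl1 n m *\<^sub>v u"
    using a p by (subst assoc_mult_mat_vec[of _ "n + m" n _ "n + m"]) auto
  also have "(incl2 n m * proj2 n m) *\<^sub>v ?a = incl2 n m *\<^sub>v w"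
    using a p by (subst assoc_mult_mat_vec[of _ "n + m" m _ "n + m"]) auto
  finally show ?thesis ..
qed

lemma sqnorm_incl:
  assumes "u \<in> carrier_vec n" "w \<in> carrier_vec m"
  shows "sqnorm (incl1 n m *\<^sub>v u + incl2 n m *\<^sub>v w) = sqnorm u + sqnorm w"
  unfolding incl_vec[OF assms] using assms by (auto simp: sqnorm_def sum_lessThan_add intro!: sum.cong)

lemma sqnorm_incl1: 
  assumes "u \<in> carrier_vec n"
  shows "sqnorm (incl1 n m *\<^sub>v u) = sqnorm u"
proof -
  have "incl2 n m *\<^sub>v 0\<^sub>v m = 0\<^sub>v (n + m)" by (intro eq_vecI) auto
  moreover have "incl1 n m *\<^sub>v u \<in> carrier_vec (n + m)" by (rule mult_mat_vec_carrier[OF proj_incl_carrier(3) assms])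
  ultimately show ?thesis using sqnorm_incl[OF assms, of "0\<^sub>v m" m] by (simp add: sqnorm_def)
qed

lemma sqnorm_incl2: 
  assumes "u \<in> carrier_vec m"
  shows "sqnorm (incl2 n m *\<^sub>v u) = sqnorm u"
proof -
  have "incl1 n m *\<^sub>v 0\<^sub>v n = 0\<^sub>v (n + m)" by (intro eq_vecI) auto
  moreover have "incl2 n m *\<^sub>v u \<in> carrier_vec (n + m)" by (rule mult_mat_vec_carrier[OF proj_incl_carrier(4) assms])
  ultimately show ?thesis using sqnorm_incl[of "0\<^sub>v n" n u m] assms by (simp add: sqnorm_def)
qed

text \<open>Members of the commutative algebra spanned by 1 and an idempotent \<open>P\<close>. All
  auxiliary matrices of the corner argument have this form: \<open>S = t + (1 - t) P\<close>, its
  inverse with \<open>1/t\<close> in place of \<open>t\<close>, the reflection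
  \<open>U = 2 P - 1\<close> and the complementary projection \<open>L = 1 - P\<close>.\<close>

definition affine_mat :: "complex \<Rightarrow> complex \<Rightarrow> nat \<Rightarrow> complex mat \<Rightarrow> complex mat" where
  "affine_mat a b n P = a \<cdot>\<^sub>m 1\<^sub>m n + b \<cdot>\<^sub>m P"

lemma affine_mat_carrier: "P \<in> carrier_mat n n \<Longrightarrow> affine_mat a b n P \<in> carrier_mat n n"
  by (simp add: affine_mat_def)

lemma affine_mat_mult_left:
  assumes P: "P \<in> carrier_mat n n" and B: "B \<in> carrier_mat n m"
  shows "affine_mat a b n P * B = a \<cdot>\<^sub>m B + b \<cdot>\<^sub>m (P * B)"
  unfolding affine_mat_def using P B
  by (simp add: add_mult_distrib_mat[of _ n n] mult_smult_assoc_mat[of _ n n])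

lemma affine_mat_mult_right:
  assumes P: "P \<in> carrier_mat n n" and B: "B \<in> carrier_mat m n"
  shows "B * affine_mat a b n P = a \<cdot>\<^sub>m B + b \<cdot>\<^sub>m (B * P)"
  unfolding affine_mat_def using P B
  by (simp add: mult_add_distrib_mat[of _ m n _ n] mult_smult_distrib[of _ m n _ n])

lemma affine_mat_mult_vec:
  assumes P: "P \<in> carrier_mat n n" and v: "v \<in> carrier_vec n"
  shows "affine_mat a b n P *\<^sub>v v = a \<cdot>\<^sub>v v + b \<cdot>\<^sub>v (P *\<^sub>v v)"
proof -
  have "(c \<cdot>\<^sub>m B) *\<^sub>v v = c \<cdot>\<^sub>v (B *\<^sub>v v)" if "B \<in> carrier_mat n n" for c B
    using that v by (intro eq_vecI) auto
  then show ?thesis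
    unfolding affine_mat_def using P v by (simp add: add_mult_distrib_mat_vec[of _ n n])
qed

lemma affine_mat_mult:
  assumes P: "P \<in> carrier_mat n n" "P * P = P"
  shows "affine_mat a b n P * affine_mat c d n P = affine_mat (a * c) (a * d + b * c + b * d) n P"
proof -
  have "P * affine_mat c d n P = c \<cdot>\<^sub>m P + d \<cdot>\<^sub>m P"
    using P by (simp add: affine_mat_mult_right)
  then show ?thesis
    unfolding affine_mat_mult_left[OF P(1) affine_mat_carrier[OF P(1)]] using P
    by (intro eq_matI) (auto simp: affine_mat_def algebra_simps)
qed

text \<open>Written entrywise, so that comparing two such conjugations of \<open>B\<close> becomes
  an identity between complex scalars.\<close>

lemma affine_mat_conj:
  assumes P: "P \<in> carrier_mat n n" and B: "B \<in> carrier_mat n n" and i: "i < n" and j: "j < n"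
  shows "(affine_mat a b n P * B * affine_mat c d n P) $$ (i,j) =
    a * c * B $$ (i,j) + a * d * (B * P) $$ (i,j) + b * c * (P * B) $$ (i,j) + b * d * (P * B * P) $$ (i,j)"
proof -
  have PB: "P * B \<in> carrier_mat n n" "B * P \<in> carrier_mat n n" "P * B * P \<in> carrier_mat n n" using P B by auto
  have "(a \<cdot>\<^sub>m B + b \<cdot>\<^sub>m (P * B)) * P = a \<cdot>\<^sub>m (B * P) + b \<cdot>\<^sub>m (P * B * P)"
    using P B PB by (simp add: add_mult_distrib_mat[of _ n n] mult_smult_assoc_mat[of _ n n])
  then have "affine_mat a b n P * B * affine_mat c d n P =
      c \<cdot>\<^sub>m (a \<cdot>\<^sub>m B + b \<cdot>\<^sub>m (P * B)) + d \<cdot>\<^sub>m (a \<cdot>\<^sub>m (B * P) + b \<cdot>\<^sub>m (P * B * P))"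
    unfolding affine_mat_mult_left[OF P B] using B PB P
    by (subst affine_mat_mult_right[OF P]) auto
  then show ?thesis using i j B P PB by (simp add: algebra_simps del: index_mult_mat(1))
qed

lemma affine_mat_one: "P \<in> carrier_mat n n \<Longrightarrow> affine_mat 1 0 n P = 1\<^sub>m n"
  by (intro eq_matI) (auto simp: affine_mat_def)

lemma reflection_hermitian:
  assumes "orth_proj n P"
  shows "hermitian n (affine_mat (-1) 2 n P)"
  unfolding hermitian_def
proof (intro conjI allI impI)
  note c = orth_proj_carrier[OF assms]
  show "affine_mat (-1) 2 n P \<in> carrier_mat n n" using c by (rule affine_mat_carrier)
  fix i j assume ij: "i < n" "j < n"
  have "P $$ (i,j) = cnj (P $$ (j,i))" using assms ij by (intro hermitianD) (auto simp: orth_proj_def)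
  then show "affine_mat (-1) 2 n P $$ (i,j) = cnj (affine_mat (-1) 2 n P $$ (j,i))"
    using ij c by (simp add: affine_mat_def)
qed

lemma sqnorm_reflection:
  assumes P: "orth_proj n P" and v: "v \<in> carrier_vec n"
  shows "sqnorm (affine_mat (-1) 2 n P *\<^sub>v v) = sqnorm v"
proof (rule sqnorm_hermitian_involution[OF reflection_hermitian[OF P] _ v])
  show "affine_mat (-1) 2 n P * affine_mat (-1) 2 n P = 1\<^sub>m n"
    using P orth_proj_carrier[OF P] by (simp add: affine_mat_mult orth_proj_def affine_mat_one)
qed

text \<open>Cauchy-Schwarz for the row \<open>[r, s]\<close> of length 1. It supplies the row
  hypothesis of the convexity lemma when \<open>C1\<close> is \<open>r\<close> times the identity
  and \<open>C2\<close> is \<open>s\<close> times a unitary.\<close>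

lemma sqnorm_add_le:
  fixes r s :: real
  assumes "u \<in> carrier_vec n" "v \<in> carrier_vec n" "r\<^sup>2 + s\<^sup>2 = 1"
  shows "sqnorm (complex_of_real r \<cdot>\<^sub>v u + complex_of_real s \<cdot>\<^sub>v v) \<le> sqnorm u + sqnorm v"
proof -
  have le: "(cmod (complex_of_real r * a + complex_of_real s * b))\<^sup>2 \<le> (cmod a)\<^sup>2 + (cmod b)\<^sup>2" for a b
  proof -
    have "cmod (complex_of_real r * a + complex_of_real s * b) \<le> \<bar>r\<bar> * cmod a + \<bar>s\<bar> * cmod b"
      by (rule order_trans[OF norm_triangle_ineq]) (simp add: norm_mult)
    then have "(cmod (complex_of_real r * a + complex_of_real s * b))\<^sup>2 \<le> (\<bar>r\<bar> * cmod a + \<bar>s\<bar> * cmod b)\<^sup>2"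
      by (intro power_mono) auto
    \<comment> \<open>The added square completes Lagrange's identity, which makes the next line an
      equality.\<close>
    also have "\<dots> \<le> (\<bar>r\<bar> * cmod a + \<bar>s\<bar> * cmod b)\<^sup>2 + (\<bar>r\<bar> * cmod b - \<bar>s\<bar> * cmod a)\<^sup>2" by simp
    also have "\<dots> = (r\<^sup>2 + s\<^sup>2) * ((cmod a)\<^sup>2 + (cmod b)\<^sup>2)"
      by (simp add: power2_eq_square algebra_simps)
    finally show ?thesis using assms by simp
  qed
  have "sqnorm (complex_of_real r \<cdot>\<^sub>v u + complex_of_real s \<cdot>\<^sub>v v) =
      (\<Sum>i<n. (cmod (complex_of_real r * vec_index u i + complex_of_real s * vec_index v i))\<^sup>2)"
    using assms by (simp add: sqnorm_def)
  also have "\<dots> \<le> (\<Sum>i<n. (cmod (vec_index u i))\<^sup>2 + (cmod (vec_index v i))\<^sup>2)"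
    by (intro sum_mono le)
  also have "\<dots> = sqnorm u + sqnorm v" using assms by (simp add: sqnorm_def sum.distrib)
  finally show ?thesis .
qed

lemma smult_mat_vec:
  assumes "B \<in> carrier_mat n m" "v \<in> carrier_vec m"
  shows "(c \<cdot>\<^sub>m B) *\<^sub>v v = c \<cdot>\<^sub>v (B *\<^sub>v (v :: complex Matrix.vec))"
  using assms by (intro eq_vecI) auto

section \<open>Stability of basic free open sets under sums, summands and certain
  similarities\<close>

locale nc_algebra = complex_space scl
  for scl :: "complex \<Rightarrow> 'v::ab_group_add \<Rightarrow> 'v" +
  fixes \<Xi> :: "'v mat set" and A :: "('v mat \<Rightarrow> complex mat) set"
  assumes full: "full_nc_set scl \<Xi>" and alg: "nc_function_algebra scl \<Xi> A"
begin

lemma in_Xi_carrier: "x \<in> \<Xi> \<Longrightarrow> x \<in> carrier_mat (dim_row x) (dim_row x) \<and> 0 < dim_row x"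
  using full by (auto simp: full_nc_set_def nc_set_def nc_space_def)

lemma full_memI:
  assumes "x \<in> \<Xi>" "x \<in> carrier_mat n n" "y \<in> nc_space" "y \<in> carrier_mat m m" "S \<in> carrier_mat n m"
    and "inj_on (\<lambda>v. S *\<^sub>v v) (carrier_vec m)" "left_act scl S y = right_act scl x S"
  shows "y \<in> \<Xi>"
proof -
  have "dim_row x = n" "dim_row y = m" using assms by auto
  then show ?thesis using full assms unfolding full_nc_set_def by metis
qed

lemma direct_sum_in_Xi: "x \<in> \<Xi> \<Longrightarrow> y \<in> \<Xi> \<Longrightarrow> direct_sum x y \<in> \<Xi>"
  using full by (auto simp: full_nc_set_def nc_set_def)

lemma algebra_nc: "q \<in> A \<Longrightarrow> nc_function scl \<Xi> q"
  using alg by (simp add: nc_function_algebra_def)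

lemma algebra_carrier: "q \<in> A \<Longrightarrow> x \<in> \<Xi> \<Longrightarrow> x \<in> carrier_mat n n \<Longrightarrow> q x \<in> carrier_mat n n"
  using nc_function_carrier[OF algebra_nc] by blast

lemma basic_subset_Xi: "x \<in> basic_free_open \<Xi> Q \<Longrightarrow> x \<in> \<Xi>"
  by (simp add: basic_free_open_def)

lemma matrices_overD: "Q \<in> matrices_over A \<Longrightarrow> q \<in> elements_mat Q \<Longrightarrow> q \<in> A"
  by (auto simp: matrices_over_def)

text \<open>The inclusions form the row and the projections the column of the convexity lemma; both
  are isometric.\<close>

lemma direct_sum_in_basic:
  assumes Q: "Q \<in> matrices_over A" and x: "x \<in> basic_free_open \<Xi> Q" and y: "y \<in> basic_free_open \<Xi> Q"
  shows "direct_sum x y \<in> basic_free_open \<Xi> Q"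
proof -
  define n m where "n = dim_row x" and "m = dim_row y"
  have X: "x \<in> \<Xi>" "y \<in> \<Xi>" using x y by (auto simp: basic_free_open_def)
  then have c: "x \<in> carrier_mat n n" "y \<in> carrier_mat m m" using in_Xi_carrier by (auto simp: n_def m_def)
  note S = direct_sum_in_Xi[OF X] and sc = direct_sum_carrier[OF c]
  have "op_norm (mat_fun_eval Q (direct_sum x y)) < 1"
  proof (rule op_norm_mat_fun_eval_convex[where ?C1.0 = "incl1 n m" and ?C2.0 = "incl2 n m"
        and ?R1.0 = "proj1 n m" and ?R2.0 = "proj2 n m"])
    show "op_norm (mat_fun_eval Q x) < 1" "op_norm (mat_fun_eval Q y) < 1"
      using x y by (auto simp: basic_free_open_def)
    show "dim_row (direct_sum x y) = n + m" using sc by simp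
    show "q x \<in> carrier_mat n n" "q y \<in> carrier_mat m m" if "q \<in> elements_mat Q" for q
      using algebra_carrier[OF matrices_overD[OF Q that]] X c by auto
    show "q (direct_sum x y) = incl1 n m * q x * proj1 n m + incl2 n m * q y * proj2 n m"
      if "q \<in> elements_mat Q" for q
      by (rule nc_function_direct_sum(3)[OF algebra_nc[OF matrices_overD[OF Q that]] X S c])
  qed (auto simp: n_def m_def sqnorm_proj sqnorm_incl)
  then show ?thesis using S by (simp add: basic_free_open_def)
qed

lemma summand_in_basic:
  assumes Q: "Q \<in> matrices_over A" and X: "x \<in> \<Xi>" "y \<in> \<Xi>"
    and xy: "direct_sum x y \<in> basic_free_open \<Xi> Q"
  shows "x \<in> basic_free_open \<Xi> Q" "y \<in> basic_free_open \<Xi> Q"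
proof -
  define n m where "n = dim_row x" and "m = dim_row y"
  have c: "x \<in> carrier_mat n n" "y \<in> carrier_mat m m" using X in_Xi_carrier by (auto simp: n_def m_def)
  note S = direct_sum_in_Xi[OF X] and sc = direct_sum_carrier[OF c]
  have lt: "op_norm (mat_fun_eval Q (direct_sum x y)) < 1" using xy by (simp add: basic_free_open_def)
  have qc: "q (direct_sum x y) \<in> carrier_mat (n + m) (n + m)" if "q \<in> elements_mat Q" for q
    using algebra_carrier[OF matrices_overD[OF Q that]] S sc by auto
  \<comment> \<open>A compression is the convexity lemma with zero second coefficients; the direct
    sum is repeated as the second point merely to fill that place.\<close>
  have summand: "op_norm (mat_fun_eval Q z) < 1"
    if k: "dim_row z = k" and CR: "C \<in> carrier_mat k (n + m)" "R \<in> carrier_mat (n + m) k"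
      and q: "\<And>q. q \<in> A \<Longrightarrow> q z = C * q (direct_sum x y) * R"
      and Rc: "\<And>w. w \<in> carrier_vec k \<Longrightarrow> sqnorm (R *\<^sub>v w) \<le> sqnorm w"
      and Cc: "\<And>u. u \<in> carrier_vec (n + m) \<Longrightarrow> sqnorm (C *\<^sub>v u) \<le> sqnorm u"
    for z k C R
  proof (rule op_norm_mat_fun_eval_convex[where ?C1.0 = C and ?C2.0 = "0\<^sub>m k (n + m)"
        and ?R1.0 = R and ?R2.0 = "0\<^sub>m (n + m) k" and ?n1.0 = "n + m" and ?n2.0 = "n + m", OF lt lt])
    show "q (direct_sum x y) \<in> carrier_mat (n + m) (n + m)" "q (direct_sum x y) \<in> carrier_mat (n + m) (n + m)"
      if "q \<in> elements_mat Q" for q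
      using qc[OF that] by simp_all
    have z1: "0\<^sub>m k (n + m) *\<^sub>v u = 0\<^sub>v k" if "u \<in> carrier_vec (n + m)" for u :: "complex Matrix.vec"
      using that by (intro eq_vecI) auto
    have z2: "0\<^sub>m (n + m) k *\<^sub>v u = 0\<^sub>v (n + m)" if "u \<in> carrier_vec k" for u :: "complex Matrix.vec"
      using that by (intro eq_vecI) auto
    show "q z = C * q (direct_sum x y) * R + 0\<^sub>m k (n + m) * q (direct_sum x y) * 0\<^sub>m (n + m) k"
      if "q \<in> elements_mat Q" for q
    proof -
      have "C * q (direct_sum x y) * R \<in> carrier_mat k k" using CR qc[OF that] by auto
      then show ?thesis
        unfolding q[OF matrices_overD[OF Q that]] using qc[OF that] by simp
    qed
    show "sqnorm (R *\<^sub>v w) + sqnorm (0\<^sub>m (n + m) k *\<^sub>v w) \<le> sqnorm w" if "w \<in> carrier_vec k" for w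
      using Rc[OF that] by (simp add: z2[OF that] sqnorm_def[of "0\<^sub>v _"])
    show "sqnorm (C *\<^sub>v u1 + 0\<^sub>m k (n + m) *\<^sub>v u2) \<le> sqnorm u1 + sqnorm u2"
      if "u1 \<in> carrier_vec (n + m)" "u2 \<in> carrier_vec (n + m)" for u1 u2
      using Cc[OF that(1)] sqnorm_nonneg[of u2] mult_mat_vec_carrier[OF CR(1) that(1)] z1[OF that(2)]
      by (simp del: sqnorm_nonneg)
  qed (use sc k CR in auto)
  have le: "sqnorm (proj1 n m *\<^sub>v u) \<le> sqnorm u" "sqnorm (proj2 n m *\<^sub>v u) \<le> sqnorm u"
    if "u \<in> carrier_vec (n + m)" for u
    using sqnorm_proj[OF that] sqnorm_nonneg[of "proj1 n m *\<^sub>v u"] sqnorm_nonneg[of "proj2 n m *\<^sub>v u"]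
    by linarith+
  have "op_norm (mat_fun_eval Q x) < 1"
    using c le nc_function_direct_sum(1)[OF algebra_nc X S c]
    by (intro summand[where C = "proj1 n m" and R = "incl1 n m" and k = n]) (auto simp: sqnorm_incl1)
  moreover have "op_norm (mat_fun_eval Q y) < 1"
    using c le nc_function_direct_sum(2)[OF algebra_nc X S c]
    by (intro summand[where C = "proj2 n m" and R = "incl2 n m" and k = m]) (auto simp: sqnorm_incl2)
  ultimately show "x \<in> basic_free_open \<Xi> Q" "y \<in> basic_free_open \<Xi> Q"
    using X by (auto simp: basic_free_open_def)
qed

text \<open>
  Conjugating by \<open>S = P + t (1 - P)\<close> multiplies the off-diagonal corner of each \<open>q(x)\<close> by \<open>t\<close>, that is,
  replaces \<open>q(x)\<close> by \<open>((1 + t) q(x) + (1 - t) U q(x) U) / 2\<close> with the unitary \<open>U = 2 P - 1\<close>.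
\<close>
lemma similar_in_basic:
  fixes t :: real
  assumes Q: "Q \<in> matrices_over A" and x: "x \<in> basic_free_open \<Xi> Q" "x \<in> carrier_mat n n"
    and P: "orth_proj n P" and inv: "\<And>q. q \<in> A \<Longrightarrow> P * q x * P = q x * P"
    and t: "0 < t" "t \<le> 1"
  defines "S \<equiv> affine_mat (complex_of_real t) (complex_of_real (1 - t)) n P"
  obtains y where "y \<in> basic_free_open \<Xi> Q" "y \<in> carrier_mat n n" "left_act scl S y = right_act scl x S"
proof
  note Pc = orth_proj_carrier[OF P]
  have PP: "P * P = P" using P by (simp add: orth_proj_def)
  \<comment> \<open>\<open>T = P + (1/t) (1 - P)\<close> is the inverse of \<open>S\<close>; the
    identities in \<open>coeff\<close> are the coefficients of \<open>S * T\<close> and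
    \<open>T * S\<close> produced by \<open>affine_mat_mult\<close>.\<close>
  define T where "T = affine_mat (complex_of_real (1 / t)) (complex_of_real (1 - 1 / t)) n P"
  have Sc: "S \<in> carrier_mat n n" and Tc: "T \<in> carrier_mat n n"
    unfolding S_def T_def by (simp_all add: affine_mat_carrier[OF Pc])
  have coeff: "complex_of_real t * complex_of_real (1 / t) = 1"
    "complex_of_real t * complex_of_real (1 - 1 / t) + complex_of_real (1 - t) * complex_of_real (1 / t)
      + complex_of_real (1 - t) * complex_of_real (1 - 1 / t) = 0"
    "complex_of_real (1 / t) * complex_of_real (1 - t) + complex_of_real (1 - 1 / t) * complex_of_real t
      + complex_of_real (1 - 1 / t) * complex_of_real (1 - t) = 0" "complex_of_real (1 / t) * complex_of_real t = 1"
    using t by (simp_all add: field_simps)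
  have ST: "S * T = 1\<^sub>m n"
    unfolding S_def T_def affine_mat_mult[OF Pc PP] coeff by (rule affine_mat_one[OF Pc])
  have TS: "T * S = 1\<^sub>m n"
    unfolding S_def T_def affine_mat_mult[OF Pc PP] coeff by (rule affine_mat_one[OF Pc])
  define y where "y = left_act scl T (right_act scl x S)"
  have xX: "x \<in> \<Xi>" using x by (simp add: basic_free_open_def)
  have rc: "right_act scl x S \<in> carrier_mat n n" by (rule right_act_carrier[OF x(2) Sc])
  show yc: "y \<in> carrier_mat n n" unfolding y_def by (rule left_act_carrier[OF Tc rc])
  show int: "left_act scl S y = right_act scl x S"
    unfolding y_def left_act_mult[OF Sc Tc rc, symmetric] ST by (rule left_act_one[OF rc])
  \<comment> \<open>Fullness of \<open>\<Xi>\<close> applies to \<open>y = T x S\<close> because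
    \<open>S\<close> is injective and satisfies \<open>S y = x S\<close>.\<close>
  have "inj_on (\<lambda>v. S *\<^sub>v v) (carrier_vec n)"
  proof (rule inj_onI)
    fix v w assume v: "v \<in> carrier_vec n" "w \<in> carrier_vec n" and e: "S *\<^sub>v v = S *\<^sub>v w"
    have "T *\<^sub>v (S *\<^sub>v v) = v" "T *\<^sub>v (S *\<^sub>v w) = w"
      using v by (simp_all add: assoc_mult_mat_vec[OF Tc Sc, symmetric] TS del: assoc_mult_mat_vec)
    then show "v = w" using e by metis
  qed
  moreover have "y \<in> nc_space" using yc in_Xi_carrier[OF xX] x(2) by (auto simp: nc_space_def)
  ultimately have yX: "y \<in> \<Xi>"
    by (intro full_memI[OF xX x(2) _ yc Sc _ int])
  \<comment> \<open>The weights \<open>(1 + t)/2\<close> and \<open>(1 - t)/2\<close> are split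
    evenly between the left and the right factors, hence the square roots; \<open>t \<le> 1\<close>
    keeps the second weight nonnegative.\<close>
  define r where "r = sqrt ((1 + t) / 2)"
  define s where "s = sqrt ((1 - t) / 2)"
  have rs: "r\<^sup>2 = (1 + t) / 2" "s\<^sup>2 = (1 - t) / 2" using t by (auto simp: r_def s_def)
  then have rs1: "r\<^sup>2 + s\<^sup>2 = 1" by (simp add: field_simps)
  have rsc: "complex_of_real r * complex_of_real r = complex_of_real ((1 + t) / 2)"
    "complex_of_real s * complex_of_real s = complex_of_real ((1 - t) / 2)"
    unfolding rs[symmetric] by (simp_all add: power2_eq_square)
  define U where "U = affine_mat (-1) 2 n P"
  have Uc: "U \<in> carrier_mat n n" unfolding U_def by (rule affine_mat_carrier[OF Pc])
  let ?C1 = "complex_of_real r \<cdot>\<^sub>m 1\<^sub>m n" and ?C2 = "complex_of_real s \<cdot>\<^sub>m U"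
  have Uv: "U *\<^sub>v v \<in> carrier_vec n" "sqnorm (U *\<^sub>v v) = sqnorm v" if "v \<in> carrier_vec n" for v
    using mult_mat_vec_carrier[OF Uc that] sqnorm_reflection[OF P that] by (auto simp: U_def)
  have C1v: "?C1 *\<^sub>v v = complex_of_real r \<cdot>\<^sub>v v" if "v \<in> carrier_vec n" for v
    using that by (simp add: smult_mat_vec[of _ n n])
  have C2v: "?C2 *\<^sub>v v = complex_of_real s \<cdot>\<^sub>v (U *\<^sub>v v)" if "v \<in> carrier_vec n" for v
    by (rule smult_mat_vec[OF Uc that])
  have qc: "q x \<in> carrier_mat n n" if "q \<in> elements_mat Q" for q
    using algebra_carrier[OF matrices_overD[OF Q that] xX x(2)] .
  have lt: "op_norm (mat_fun_eval Q x) < 1" using x by (simp add: basic_free_open_def)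
  have "op_norm (mat_fun_eval Q y) < 1"
  proof (rule op_norm_mat_fun_eval_convex[where ?C1.0 = ?C1 and ?C2.0 = ?C2 and ?R1.0 = ?C1 and ?R2.0 = ?C2
        and ?n1.0 = n and ?n2.0 = n, OF lt lt])
    show "q x \<in> carrier_mat n n" "q x \<in> carrier_mat n n" if "q \<in> elements_mat Q" for q
      using qc[OF that] by simp_all
    show "dim_row y = n" "dim_row x = n" "dim_row x = n" using yc x(2) by auto
    show "?C1 \<in> carrier_mat n n" "?C2 \<in> carrier_mat n n" "?C1 \<in> carrier_mat n n" "?C2 \<in> carrier_mat n n"
      using Uc by auto
    show "sqnorm (?C1 *\<^sub>v w) + sqnorm (?C2 *\<^sub>v w) \<le> sqnorm w" if "w \<in> carrier_vec n" for w
    proof -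
      have "sqnorm (?C1 *\<^sub>v w) + sqnorm (?C2 *\<^sub>v w) = (r\<^sup>2 + s\<^sup>2) * sqnorm w"
        by (simp add: C1v[OF that] C2v[OF that] sqnorm_smult Uv[OF that] distrib_right)
      then show ?thesis using rs1 by simp
    qed
    show "sqnorm (?C1 *\<^sub>v u1 + ?C2 *\<^sub>v u2) \<le> sqnorm u1 + sqnorm u2"
      if "u1 \<in> carrier_vec n" "u2 \<in> carrier_vec n" for u1 u2
      using sqnorm_add_le[OF that(1) Uv(1)[OF that(2)] rs1]
      by (simp add: C1v[OF that(1)] C2v[OF that(2)] Uv[OF that(2)])
    show "q y = ?C1 * q x * ?C1 + ?C2 * q x * ?C2" if "q \<in> elements_mat Q" for q
    proof -
      note qA = matrices_overD[OF Q that]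
      define B where "B = q x"
      have Bc: "B \<in> carrier_mat n n" using qc[OF that] by (simp add: B_def)
      have qy: "q y \<in> carrier_mat n n" by (rule algebra_carrier[OF qA yX yc])
      have SB: "S * q y = B * S"
        unfolding B_def by (rule nc_function_intertwines[OF algebra_nc[OF qA] yX xX yc x(2) Sc int])
      have "q y = (T * S) * q y" using qy by (simp add: TS)
      also have "\<dots> = T * B * S" using Tc Sc qy Bc SB by (simp add: assoc_mult_mat[of _ n n _ n _ n])
      finally have e1: "q y = T * B * S" .
      have e2: "?C1 * B * ?C1 = complex_of_real ((1 + t) / 2) \<cdot>\<^sub>m B"
        using Bc by (intro eq_matI) (auto simp: mult_smult_assoc_mat[of _ n n] mult_smult_distrib[of _ n n] rsc mult.assoc[symmetric])
      have e3: "?C2 * B * ?C2 = complex_of_real ((1 - t) / 2) \<cdot>\<^sub>m (U * B * U)"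
        using Bc Uc by (intro eq_matI)
          (auto simp: mult_smult_assoc_mat[of _ n n] mult_smult_distrib[of _ n n] rsc mult.assoc[symmetric] simp del: index_mult_mat(1))
      have PBP: "P * B * P = B * P" using inv[OF qA] by (simp add: B_def)
      \<comment> \<open>By \<open>P B P = B P\<close>, expanding either side gives
        \<open>B + (1 - t) (B P - P B)\<close>.\<close>
      have "T * B * S = complex_of_real ((1 + t) / 2) \<cdot>\<^sub>m B + complex_of_real ((1 - t) / 2) \<cdot>\<^sub>m (U * B * U)"
      proof (rule eq_matI)
        fix i j
        assume "i < dim_row (complex_of_real ((1 + t) / 2) \<cdot>\<^sub>m B + complex_of_real ((1 - t) / 2) \<cdot>\<^sub>m (U * B * U))"
          "j < dim_col (complex_of_real ((1 + t) / 2) \<cdot>\<^sub>m B + complex_of_real ((1 - t) / 2) \<cdot>\<^sub>m (U * B * U))"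
        then have ij: "i < n" "j < n" using Uc by auto
        have UBU: "U * B * U \<in> carrier_mat n n" using Uc Bc by auto
        have "(complex_of_real ((1 + t) / 2) \<cdot>\<^sub>m B + complex_of_real ((1 - t) / 2) \<cdot>\<^sub>m (U * B * U)) $$ (i,j) =
            complex_of_real ((1 + t) / 2) * B $$ (i,j) + complex_of_real ((1 - t) / 2) * (U * B * U) $$ (i,j)"
          using ij Bc Uc by (simp del: index_mult_mat(1))
        moreover have "(T * B * S) $$ (i,j) =
            complex_of_real ((1 + t) / 2) * B $$ (i,j) + complex_of_real ((1 - t) / 2) * (U * B * U) $$ (i,j)"
          unfolding T_def S_def U_def affine_mat_conj[OF Pc Bc ij] PBP
          using t by (simp add: field_simps del: index_mult_mat(1))
        ultimately show "(T * B * S) $$ (i,j) =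
          (complex_of_real ((1 + t) / 2) \<cdot>\<^sub>m B + complex_of_real ((1 - t) / 2) \<cdot>\<^sub>m (U * B * U)) $$ (i,j)"
          by simp
      qed (use Tc Sc Uc in auto)
      then show ?thesis using e1 e2 e3 by (simp add: B_def)
    qed
  qed
  then show "y \<in> basic_free_open \<Xi> Q" using yX by (simp add: basic_free_open_def)
qed

end

section \<open>Values of free holomorphic functions\<close>

lemma eq_mat_vecI:
  fixes B C :: "'a::semiring_1 mat"
  assumes B: "B \<in> carrier_mat n m" and C: "C \<in> carrier_mat n m"
    and eq: "\<And>v. v \<in> carrier_vec m \<Longrightarrow> B *\<^sub>v v = C *\<^sub>v v"
  shows "B = C"
proof (rule eq_matI)
  fix i j assume "i < dim_row C" "j < dim_col C"
  then have ij: "i < n" "j < m" using C by auto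
  have "vec_index (B *\<^sub>v unit_vec m j) i = vec_index (C *\<^sub>v unit_vec m j) i"
    by (simp only: eq[OF unit_vec_carrier])
  then show "B $$ (i,j) = C $$ (i,j)"
    using ij B C by (simp add: scalar_prod_right_unit[of j m])
qed (use B C in auto)

lemma op_norm_zero: "op_norm (0\<^sub>m n m) = 0"
proof -
  have "op_norm (0\<^sub>m n m) \<le> 0"
    by (rule op_norm_le) (auto simp: sqnorm_def)
  then show ?thesis using op_norm_nonneg[of "0\<^sub>m n m"] by simp
qed

lemma mat_fun_eval_single:
  assumes "p z \<in> carrier_mat (dim_row z) (dim_row z)"
  shows "mat_fun_eval (mat 1 1 (\<lambda>_. p)) z = p z"
  using assms by (intro eq_matI) (auto simp: mat_fun_eval_def Let_def)

context nc_algebra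
begin

lemma algebra_add: "p \<in> A \<Longrightarrow> q \<in> A \<Longrightarrow> \<exists>r\<in>A. \<forall>x\<in>\<Xi>. r x = p x + q x"
  and algebra_smult: "p \<in> A \<Longrightarrow> \<exists>r\<in>A. \<forall>x\<in>\<Xi>. r x = c \<cdot>\<^sub>m p x"
  and algebra_mult: "p \<in> A \<Longrightarrow> q \<in> A \<Longrightarrow> \<exists>r\<in>A. \<forall>x\<in>\<Xi>. r x = p x * q x"
  using alg by (auto simp: nc_function_algebra_def)

text \<open>Here \<open>M\<close> is the orbit \<open>A(x) v\<close> and \<open>P\<close> projects
  onto it. The corner is tested on the single vector \<open>v\<close>: once
  \<open>(1 - P) f(x) v = 0\<close>, the vector \<open>f(x) v\<close> lies in the range of
  \<open>P\<close>, which is inside \<open>M\<close>.\<close>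

lemma bounded_nc_value_in_orbit:
  assumes Q: "Q \<in> matrices_over A" and x: "x \<in> basic_free_open \<Xi> Q" "x \<in> carrier_mat n n"
    and f: "nc_function scl (basic_free_open \<Xi> Q) f"
    and C: "\<And>z. z \<in> basic_free_open \<Xi> Q \<Longrightarrow> op_norm (f z) \<le> C"
    and e: "e \<in> A" "\<And>z. z \<in> \<Xi> \<Longrightarrow> e z = 1\<^sub>m (dim_row z)"
    and v: "v \<in> carrier_vec n"
  shows "\<exists>q\<in>A. f x *\<^sub>v v = q x *\<^sub>v v"
proof -
  have xX: "x \<in> \<Xi>" using x by (simp add: basic_free_open_def)
  have qc: "q x \<in> carrier_mat n n" if "q \<in> A" for q by (rule algebra_carrier[OF that xX x(2)])
  define M where "M = {q x *\<^sub>v v |q. q \<in> A}"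
  have Mc: "M \<subseteq> carrier_vec n" using mult_mat_vec_carrier[OF qc v] by (auto simp: M_def)
  \<comment> \<open>The unit of \<open>A\<close> puts \<open>v\<close> into its own orbit, so that
    \<open>P\<close>, and later \<open>S\<close>, fixes \<open>v\<close>.\<close>
  have vM: "v \<in> M" unfolding M_def using e(1) e(2)[OF xX] x(2) v by (auto intro!: exI[of _ e])
  have Msm: "a \<cdot>\<^sub>v w \<in> M" if w: "w \<in> M" for a w
  proof -
    obtain q where q: "q \<in> A" "w = q x *\<^sub>v v" using w by (auto simp: M_def)
    obtain r where r: "r \<in> A" "r x = a \<cdot>\<^sub>m q x" using algebra_smult[OF q(1)] xX by blast
    show ?thesis using r smult_mat_vec[OF qc[OF q(1)] v] q(2) by (auto simp: M_def intro!: exI[of _ r])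
  qed
  have M0: "0\<^sub>v n \<in> M" 
  proof -
    have "0 \<cdot>\<^sub>v v = 0\<^sub>v n" using v by (intro eq_vecI) auto
    then show ?thesis using Msm[OF vM, of 0] by simp
  qed
  have Mad: "u + w \<in> M" if uw: "u \<in> M" "w \<in> M" for u w
  proof -
    obtain p q where q: "p \<in> A" "u = p x *\<^sub>v v" "q \<in> A" "w = q x *\<^sub>v v" using uw by (auto simp: M_def)
    obtain r where r: "r \<in> A" "r x = p x + q x" using algebra_add[OF q(1,3)] xX by blast
    show ?thesis
      using r add_mult_distrib_mat_vec[OF qc[OF q(1)] qc[OF q(3)] v] q by (auto simp: M_def intro!: exI[of _ r])
  qed
  have Mq: "q x *\<^sub>v w \<in> M" if q: "q \<in> A" and w: "w \<in> M" for q w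
  proof -
    obtain p where p: "p \<in> A" "w = p x *\<^sub>v v" using w by (auto simp: M_def)
    obtain r where r: "r \<in> A" "r x = q x * p x" using algebra_mult[OF q p(1)] xX by blast
    show ?thesis
      using r assoc_mult_mat_vec[OF qc[OF q] qc[OF p(1)] v] p by (auto simp: M_def intro!: exI[of _ r])
  qed
  obtain P where P: "orth_proj n P" and PM: "\<And>w. w \<in> carrier_vec n \<Longrightarrow> P *\<^sub>v w \<in> M"
    and PI: "\<And>w. w \<in> M \<Longrightarrow> P *\<^sub>v w = w"
    using orth_proj_exists[OF Mc M0 Mad Msm] by blast
  note Pc = orth_proj_carrier[OF P]
  have PP: "P * P = P" using P by (simp add: orth_proj_def)
  have inv: "P * q x * P = q x * P" if q: "q \<in> A" for q
  proof (rule eq_mat_vecI)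
    note c = qc[OF q]
    show "P * q x * P \<in> carrier_mat n n" "q x * P \<in> carrier_mat n n" using Pc c by auto
    fix w :: "complex Matrix.vec" assume w: "w \<in> carrier_vec n"
    have Pw: "P *\<^sub>v w \<in> carrier_vec n" by (rule mult_mat_vec_carrier[OF Pc w])
    have "(P * q x * P) *\<^sub>v w = P *\<^sub>v (q x *\<^sub>v (P *\<^sub>v w))"
      using Pc c w Pw by (simp add: assoc_mult_mat_vec[of _ n n _ n])
    also have "\<dots> = q x *\<^sub>v (P *\<^sub>v w)" by (rule PI[OF Mq[OF q PM[OF w]]])
    also have "\<dots> = (q x * P) *\<^sub>v w" using Pc c w by (simp add: assoc_mult_mat_vec[of _ n n _ n])
    finally show "(P * q x * P) *\<^sub>v w = (q x * P) *\<^sub>v w" .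
  qed
  define L where "L = affine_mat 1 (-1) n P"
  have Lc: "L \<in> carrier_mat n n" unfolding L_def by (rule affine_mat_carrier[OF Pc])
  have fc: "f z \<in> carrier_mat n n" if "z \<in> basic_free_open \<Xi> Q" "z \<in> carrier_mat n n" for z
    by (rule nc_function_carrier[OF f that])
  have Fv: "f x *\<^sub>v v \<in> carrier_vec n" by (rule mult_mat_vec_carrier[OF fc[OF x] v])
  define s where "s = sqnorm (L *\<^sub>v (f x *\<^sub>v v))"
  define B where "B = (op_norm L)\<^sup>2 * (C\<^sup>2 * sqnorm v)"
  have B0: "0 \<le> B" by (simp add: B_def)
  \<comment> \<open>Since \<open>S\<close> fixes \<open>v\<close> and \<open>S y = x S\<close>, we
    have \<open>f(x) v = f(x) S v = S f(y) v\<close>. Applying \<open>L\<close> and using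
    \<open>L S = t L\<close> leaves \<open>L f(x) v = t L f(y) v\<close>, where \<open>f(y)\<close>
    is bounded by \<open>C\<close> whatever \<open>t\<close> is.\<close>
  have le: "s \<le> t\<^sup>2 * B" if t: "0 < t" "t \<le> 1" for t :: real
  proof -
    define S where "S = affine_mat (complex_of_real t) (complex_of_real (1 - t)) n P"
    obtain y where y: "y \<in> basic_free_open \<Xi> Q" "y \<in> carrier_mat n n"
      and int: "left_act scl S y = right_act scl x S"
      using similar_in_basic[where x = x and P = P, OF Q x P _ t] inv unfolding S_def by blast
    have Sc: "S \<in> carrier_mat n n" unfolding S_def by (rule affine_mat_carrier[OF Pc])
    have SF: "S * f y = f x * S" by (rule nc_function_intertwines[OF f y(1) x(1) y(2) x(2) Sc int])
    have Sv: "S *\<^sub>v v = v"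
      unfolding S_def affine_mat_mult_vec[OF Pc v] PI[OF vM] using v
      by (intro eq_vecI) (auto simp: algebra_simps)
    have LS: "L * S = complex_of_real t \<cdot>\<^sub>m L"
      unfolding L_def S_def affine_mat_mult[OF Pc PP] using Pc
      by (intro eq_matI) (auto simp: affine_mat_def algebra_simps)
    have yv: "f y *\<^sub>v v \<in> carrier_vec n" by (rule mult_mat_vec_carrier[OF fc[OF y] v])
    have "f x *\<^sub>v v = f x *\<^sub>v (S *\<^sub>v v)" by (simp only: Sv)
    also have "\<dots> = S *\<^sub>v (f y *\<^sub>v v)"
      using assoc_mult_mat_vec[OF fc[OF x] Sc v] assoc_mult_mat_vec[OF Sc fc[OF y] v] SF by simp
    finally have "L *\<^sub>v (f x *\<^sub>v v) = (L * S) *\<^sub>v (f y *\<^sub>v v)"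
      using assoc_mult_mat_vec[OF Lc Sc yv] by simp
    also have "\<dots> = complex_of_real t \<cdot>\<^sub>v (L *\<^sub>v (f y *\<^sub>v v))"
      unfolding LS by (rule smult_mat_vec[OF Lc yv])
    finally have "s = t\<^sup>2 * sqnorm (L *\<^sub>v (f y *\<^sub>v v))" by (simp add: s_def sqnorm_smult)
    also have "sqnorm (L *\<^sub>v (f y *\<^sub>v v)) \<le> (op_norm L)\<^sup>2 * sqnorm (f y *\<^sub>v v)"
      using yv Lc by (intro op_norm_bound) auto
    also have "sqnorm (f y *\<^sub>v v) \<le> (op_norm (f y))\<^sup>2 * sqnorm v"
      using v fc[OF y] by (intro op_norm_bound) auto
    also have "\<dots> \<le> C\<^sup>2 * sqnorm v"
      using C[OF y(1)] op_norm_nonneg[of "f y"] by (intro mult_right_mono power_mono) auto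
    finally show ?thesis by (simp add: B_def mult_left_mono)
  qed
  have "s = 0"
  proof (rule ccontr)
    assume "s \<noteq> 0"
    then have s: "0 < s" by (simp add: s_def less_le)
    \<comment> \<open>Chosen so that \<open>t (s + B) = s\<close>: then
      \<open>t^2 B \<le> t B < t (s + B) = s\<close> contradicts \<open>le\<close>. The choice also
      covers \<open>B = 0\<close>.\<close>
    define t where "t = s / (s + B)"
    have t: "0 < t" "t \<le> 1" using s B0 by (auto simp: t_def)
    have "s \<le> t\<^sup>2 * B" by (rule le[OF t])
    also have "\<dots> \<le> t * B" using t B0 by (intro mult_right_mono) (auto simp: power2_eq_square mult_left_le)
    also have "\<dots> < t * (s + B)" using s t by simp
    also have "\<dots> = s" using s B0 by (simp add: t_def)
    finally show False by simp
  qed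
  then have "L *\<^sub>v (f x *\<^sub>v v) = 0\<^sub>v n"
    unfolding s_def sqnorm_eq_0 using Lc by simp
  then have z: "1 \<cdot>\<^sub>v (f x *\<^sub>v v) + (-1) \<cdot>\<^sub>v (P *\<^sub>v (f x *\<^sub>v v)) = 0\<^sub>v n"
    unfolding L_def affine_mat_mult_vec[OF Pc Fv] .
  have PFv: "P *\<^sub>v (f x *\<^sub>v v) \<in> carrier_vec n" by (rule mult_mat_vec_carrier[OF Pc Fv])
  have "f x *\<^sub>v v = P *\<^sub>v (f x *\<^sub>v v)"
  proof (rule eq_vecI)
    fix i assume "i < dim_vec (P *\<^sub>v (f x *\<^sub>v v))"
    then have i: "i < n" using PFv by (simp only: carrier_vecD)
    have "vec_index (1 \<cdot>\<^sub>v (f x *\<^sub>v v) + (-1) \<cdot>\<^sub>v (P *\<^sub>v (f x *\<^sub>v v))) i =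
        vec_index (f x *\<^sub>v v) i - vec_index (P *\<^sub>v (f x *\<^sub>v v)) i"
      using i Fv PFv Pc fc[OF x] by (simp del: index_mult_mat_vec)
    then show "vec_index (f x *\<^sub>v v) i = vec_index (P *\<^sub>v (f x *\<^sub>v v)) i"
      unfolding z using i by simp
  qed (use Fv PFv in \<open>simp only: carrier_vecD\<close>)
  also have "\<dots> \<in> M" by (rule PM[OF Fv])
  finally show ?thesis by (auto simp: M_def)
qed

text \<open>\<open>X\<close> is a direct sum of copies of \<open>x\<close> and \<open>v\<close>
  stacks the vectors of the list. Keeping only the existence of intertwinings \<open>F\<close> that
  read each vector off \<open>v\<close> avoids indexing the summands: a new summand adds one
  projection and composes the old \<open>F\<close> with the other.\<close>

lemma simultaneous_orbit_point:
  assumes Q: "Q \<in> matrices_over A" and x: "x \<in> basic_free_open \<Xi> Q" "x \<in> carrier_mat n n"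
    and "set vs \<subseteq> carrier_vec n"
  shows "\<exists>X N v. X \<in> basic_free_open \<Xi> Q \<and> X \<in> carrier_mat N N \<and> v \<in> carrier_vec N \<and>
    (\<forall>u\<in>set vs. \<exists>F\<in>carrier_mat n N. left_act scl F X = right_act scl x F \<and> F *\<^sub>v v = u)"
  using assms(4)
proof (induction vs)
  case Nil
  \<comment> \<open>Matrices in an nc set have positive size, so the empty list starts from
    \<open>x\<close> itself, with a zero vector that stays as an idle block.\<close>
  then show ?case using x by (auto intro!: exI[of _ x] exI[of _ n] exI[of _ "0\<^sub>v n"])
next
  case (Cons a vs)
  then obtain X N v where X: "X \<in> basic_free_open \<Xi> Q" "X \<in> carrier_mat N N" and v: "v \<in> carrier_vec N"
    and F: "\<And>u. u \<in> set vs \<Longrightarrow> \<exists>F\<in>carrier_mat n N. left_act scl F X = right_act scl x F \<and> F *\<^sub>v v = u"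
    by auto
  have a: "a \<in> carrier_vec n" using Cons by simp
  have av: "a @\<^sub>v v \<in> carrier_vec (n + N)" using a v by simp
  note ds = direct_sum_carrier[OF x(2) X(2)]
  have p: "proj1 n N *\<^sub>v (a @\<^sub>v v) = a" "proj2 n N *\<^sub>v (a @\<^sub>v v) = v"
    using a v by (auto simp: proj1_vec[OF av] proj2_vec[OF av] intro!: eq_vecI)
  have "\<exists>F\<in>carrier_mat n (n + N). left_act scl F (direct_sum x X) = right_act scl x F \<and> F *\<^sub>v (a @\<^sub>v v) = u"
    if "u \<in> set (a # vs)" for u
  proof (cases "u = a")
    case True
    then show ?thesis
      using proj1_intertwines[OF x(2) X(2)] p by (intro bexI[of _ "proj1 n N"]) auto
  next
    case False
    then have "u \<in> set vs" using that by simp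
    then obtain F where F: "F \<in> carrier_mat n N" "left_act scl F X = right_act scl x F" "F *\<^sub>v v = u"
      using F by blast
    have "left_act scl (F * proj2 n N) (direct_sum x X) = right_act scl x (F * proj2 n N)"
      by (rule intertwining_comp[OF ds X(2) x(2) _ F(1) proj2_intertwines[OF x(2) X(2)] F(2)]) simp
    moreover have "(F * proj2 n N) *\<^sub>v (a @\<^sub>v v) = u"
      using assoc_mult_mat_vec[OF F(1) _ av, of "proj2 n N"] F(3) p by simp
    ultimately show ?thesis using F(1) by (intro bexI[of _ "F * proj2 n N"]) auto
  qed
  then show ?case
    using direct_sum_in_basic[OF Q x(1) X(1)] ds av by blast
qed

text \<open>The orbit lemma at one vector only gives a \<open>q\<close> depending on that vector.
  Applied to \<open>X\<close> and the stacked standard basis it gives a single \<open>q\<close>, and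
  the intertwinings carry \<open>f X v = q X v\<close> to every column of \<open>f x\<close> and
  \<open>q x\<close>.\<close>

lemma bounded_nc_value_in_algebra:
  assumes Q: "Q \<in> matrices_over A" and x: "x \<in> basic_free_open \<Xi> Q"
    and f: "nc_function scl (basic_free_open \<Xi> Q) f"
    and C: "\<And>z. z \<in> basic_free_open \<Xi> Q \<Longrightarrow> op_norm (f z) \<le> C"
    and e: "e \<in> A" "\<And>z. z \<in> \<Xi> \<Longrightarrow> e z = 1\<^sub>m (dim_row z)"
  shows "\<exists>q\<in>A. f x = q x"
proof -
  define n where "n = dim_row x"
  have xX: "x \<in> \<Xi>" by (rule basic_subset_Xi[OF x])
  have xc: "x \<in> carrier_mat n n" using in_Xi_carrier[OF xX] by (simp add: n_def)
  define vs :: "complex Matrix.vec list" where "vs = map (unit_vec n) [0..<n]"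
  have vs: "set vs \<subseteq> carrier_vec n" by (auto simp: vs_def)
  obtain X N v where X: "X \<in> basic_free_open \<Xi> Q" "X \<in> carrier_mat N N" and v: "v \<in> carrier_vec N"
    and F: "\<And>u. u \<in> set vs \<Longrightarrow> \<exists>F\<in>carrier_mat n N. left_act scl F X = right_act scl x F \<and> F *\<^sub>v v = u"
    using simultaneous_orbit_point[OF Q x xc vs] by auto
  obtain q where q: "q \<in> A" "f X *\<^sub>v v = q X *\<^sub>v v"
    using bounded_nc_value_in_orbit[OF Q X f C e v] by blast
  have fc: "f x \<in> carrier_mat n n" by (rule nc_function_carrier[OF f x xc])
  have qc: "q x \<in> carrier_mat n n" by (rule algebra_carrier[OF q(1) xX xc])
  have fX: "f X \<in> carrier_mat N N" by (rule nc_function_carrier[OF f X])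
  have qX: "q X \<in> carrier_mat N N" by (rule algebra_carrier[OF q(1) basic_subset_Xi[OF X(1)] X(2)])
  have col: "f x *\<^sub>v unit_vec n j = q x *\<^sub>v unit_vec n j" if j: "j < n" for j
  proof -
    have "unit_vec n j \<in> set vs" using j by (simp add: vs_def)
    then obtain F where F: "F \<in> carrier_mat n N" "left_act scl F X = right_act scl x F" "F *\<^sub>v v = unit_vec n j"
      using F by blast
    have Ff: "F * f X = f x * F" by (rule nc_function_intertwines[OF f X(1) x X(2) xc F(1,2)])
    have Fq: "F * q X = q x * F"
      by (rule nc_function_intertwines[OF algebra_nc[OF q(1)] basic_subset_Xi[OF X(1)] xX X(2) xc F(1,2)])
    have "f x *\<^sub>v unit_vec n j = (F * f X) *\<^sub>v v"
      unfolding Ff F(3)[symmetric] by (rule assoc_mult_mat_vec[OF fc F(1) v, symmetric])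
    also have "\<dots> = F *\<^sub>v (q X *\<^sub>v v)"
      unfolding q(2)[symmetric] by (rule assoc_mult_mat_vec[OF F(1) fX v])
    also have "\<dots> = (q x * F) *\<^sub>v v"
      unfolding Fq[symmetric] by (rule assoc_mult_mat_vec[OF F(1) qX v, symmetric])
    also have "\<dots> = q x *\<^sub>v unit_vec n j"
      unfolding F(3)[symmetric] by (rule assoc_mult_mat_vec[OF qc F(1) v])
    finally show ?thesis .
  qed
  have "f x = q x"
  proof (rule eq_matI)
    fix i j assume "i < dim_row (q x)" "j < dim_col (q x)"
    then have ij: "i < n" "j < n" using qc by auto
    have "vec_index (f x *\<^sub>v unit_vec n j) i = vec_index (q x *\<^sub>v unit_vec n j) i"
      by (simp only: col[OF ij(2)])
    then show "f x $$ (i,j) = q x $$ (i,j)"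
      using ij fc qc by (simp add: scalar_prod_right_unit[of j n])
  qed (use fc qc in auto)
  then show ?thesis using q(1) by blast
qed

lemma free_holomorphic_value_in_algebra:
  assumes f: "free_holomorphic scl \<Xi> A \<Omega> f" and e: "\<exists>e\<in>A. \<forall>z\<in>\<Xi>. e z = 1\<^sub>m (dim_row z)"
    and x: "x \<in> \<Omega>"
  shows "\<exists>q\<in>A. f x = q x"
proof -
  obtain Q C where Q: "Q \<in> matrices_over A" "x \<in> basic_free_open \<Xi> Q"
    "nc_function scl (basic_free_open \<Xi> Q) f" "\<And>z. z \<in> basic_free_open \<Xi> Q \<Longrightarrow> op_norm (f z) \<le> C"
    using f x unfolding free_holomorphic_def by meson
  obtain e where e: "e \<in> A" "\<And>z. z \<in> \<Xi> \<Longrightarrow> e z = 1\<^sub>m (dim_row z)" using e by blast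
  show ?thesis by (rule bounded_nc_value_in_algebra[OF Q e])
qed

section \<open>Compactness: one point of the nc set controls all of it\<close>

lemma compact_nc_subset_basic:
  assumes K: "nc_set K" "K \<noteq> {}" "K \<subseteq> \<Xi>" "compactin (free_topology \<Xi> A) K"
    and cover: "\<And>x. x \<in> K \<Longrightarrow> x \<in> basic_free_open \<Xi> (R x)"
    and R: "\<And>x. x \<in> K \<Longrightarrow> R x \<in> matrices_over A"
  shows "\<exists>x\<in>K. K \<subseteq> basic_free_open \<Xi> (R x)"
proof (rule ccontr)
  assume "\<not> ?thesis"
  then have outside: "\<exists>z\<in>K. z \<notin> basic_free_open \<Xi> (R x)" if "x \<in> K" for x using that by blast
  define \<U> where "\<U> = (\<lambda>x. basic_free_open \<Xi> (R x)) ` K"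
  have "openin (free_topology \<Xi> A) U" if "U \<in> \<U>" for U
    using that R unfolding free_topology_def \<U>_def
    by (auto intro!: topology_generated_by_Basis)
  moreover have "K \<subseteq> \<Union>\<U>" using cover by (auto simp: \<U>_def)
  ultimately obtain \<F> where \<F>: "finite \<F>" "\<F> \<subseteq> \<U>" "K \<subseteq> \<Union>\<F>"
    using compactinD[OF K(4)] by meson
  \<comment> \<open>A direct sum lies in a basic set only if both summands do. So points of
    \<open>K\<close> missing different members of the subcover combine, one member at a time, into a
    single point of \<open>K\<close> missing them all.\<close>
  have "\<exists>z\<in>K. \<forall>U\<in>\<F>. z \<notin> U" using \<F>(1,2)
  proof (induction \<F> rule: finite_induct)
    case empty
    then show ?case using K(2) by blast
  next
    case (insert U \<F>)
    then obtain z where z: "z \<in> K" "\<forall>U\<in>\<F>. z \<notin> U" by auto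
    obtain x where x: "x \<in> K" "U = basic_free_open \<Xi> (R x)" using insert by (auto simp: \<U>_def)
    obtain w where w: "w \<in> K" "w \<notin> U" using outside[OF x(1)] x(2) by blast
    have "direct_sum w z \<in> K" using K(1) w z by (auto simp: nc_set_def)
    moreover have "direct_sum w z \<notin> V" if V: "V \<in> insert U \<F>" for V
    proof
      assume dV: "direct_sum w z \<in> V"
      obtain y where y: "y \<in> K" "V = basic_free_open \<Xi> (R y)" using V insert.prems by (auto simp: \<U>_def)
      have "w \<in> V" "z \<in> V"
        using summand_in_basic[OF R[OF y(1)], of w z] dV y(2) w(1) z(1) K(3) by auto
      then show False using V w(2) z(2) by auto
    qed
    ultimately show ?case by blast
  qed
  then show False using \<F>(3) by blast
qed

text \<open>Otherwise each \<open>x\<close> in \<open>K\<close> has some \<open>p\<close> that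
  vanishes at \<open>x\<close> but not on all of \<open>K\<close>. A multiple of \<open>p\<close>
  defines a basic set that contains \<open>x\<close> and not all of \<open>K\<close>, and such sets
  cannot cover \<open>K\<close> by the preceding lemma.\<close>

lemma compact_nc_vanishing_point:
  assumes K: "nc_set K" "K \<noteq> {}" "K \<subseteq> \<Xi>" "compactin (free_topology \<Xi> A) K"
  shows "\<exists>x\<in>K. \<forall>p\<in>A. p x = 0\<^sub>m (dim_row x) (dim_row x) \<longrightarrow> (\<forall>z\<in>K. p z = 0\<^sub>m (dim_row z) (dim_row z))"
proof (rule ccontr)
  assume neg: "\<not> ?thesis"
  have "\<exists>Q\<in>matrices_over A. x \<in> basic_free_open \<Xi> Q \<and> \<not> K \<subseteq> basic_free_open \<Xi> Q" if x: "x \<in> K" for x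
  proof -
    obtain p z where p: "p \<in> A" "p x = 0\<^sub>m (dim_row x) (dim_row x)"
      and z: "z \<in> K" "p z \<noteq> 0\<^sub>m (dim_row z) (dim_row z)"
      using neg x by blast
    have X: "x \<in> \<Xi>" "z \<in> \<Xi>" using x z K(3) by auto
    have c: "q y \<in> carrier_mat (dim_row y) (dim_row y)" if "q \<in> A" "y \<in> \<Xi>" for q y
      using algebra_carrier[OF that] in_Xi_carrier[OF that(2)] by blast
    obtain i j where ij: "i < dim_row z" "j < dim_row z" "p z $$ (i,j) \<noteq> 0"
      using z(2) c[OF p(1) X(2)] by (auto simp: mat_eq_iff)
    \<comment> \<open>The scaling makes one entry of \<open>q z\<close> equal to 1, hence its norm
      at least 1, while \<open>q x\<close> remains zero.\<close>
    obtain q where q: "q \<in> A" "\<And>y. y \<in> \<Xi> \<Longrightarrow> q y = (1 / p z $$ (i,j)) \<cdot>\<^sub>m p y"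
      using algebra_smult[OF p(1)] by metis
    define Q where "Q = mat 1 1 (\<lambda>_::nat \<times> nat. q)"
    have "Q \<in> matrices_over A" using q(1) by (auto simp: matrices_over_def Q_def elements_mat_def)
    moreover have ev: "mat_fun_eval Q y = q y" if "y \<in> \<Xi>" for y
      unfolding Q_def by (rule mat_fun_eval_single[of q, OF c[OF q(1) that]])
    have "x \<in> basic_free_open \<Xi> Q"
      using X by (simp add: basic_free_open_def ev q(2) p(2) op_norm_zero)
    moreover have "1 \<le> op_norm (q z)"
    proof -
      have "cmod (q z $$ (i,j)) \<le> op_norm (q z)" using ij c[OF q(1) X(2)] by (intro op_norm_entry) auto
      moreover have "q z $$ (i,j) = 1" using ij c[OF p(1) X(2)] by (simp add: q(2)[OF X(2)])
      ultimately show ?thesis by simp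
    qed
    then have "z \<notin> basic_free_open \<Xi> Q" using X by (simp add: basic_free_open_def ev)
    ultimately show ?thesis using z(1) by blast
  qed
  then obtain R where R: "\<And>x. x \<in> K \<Longrightarrow> R x \<in> matrices_over A"
    "\<And>x. x \<in> K \<Longrightarrow> x \<in> basic_free_open \<Xi> (R x)" "\<And>x. x \<in> K \<Longrightarrow> \<not> K \<subseteq> basic_free_open \<Xi> (R x)"
    by metis
  show False using compact_nc_subset_basic[OF K R(2,1)] R(3) by blast
qed

theorem free_holomorphic_eq_on_compact:
  assumes e: "\<exists>e\<in>A. \<forall>z\<in>\<Xi>. e z = 1\<^sub>m (dim_row z)"
    and f: "free_holomorphic scl \<Xi> A \<Omega> f"
    and K: "nc_set K" "K \<subseteq> \<Omega>" "compactin (free_topology \<Xi> A) K"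
  shows "\<exists>p\<in>A. \<forall>x\<in>K. f x = p x"
\<comment> \<open>The empty set is an nc set too, but has no vanishing point; there the unit serves
  as \<open>p\<close>.\<close>
proof (cases "K = {}")
  case True
  then show ?thesis using e by blast
next
  case False
  have \<Omega>X: "x \<in> \<Xi>" if "x \<in> \<Omega>" for x
    using f that basic_subset_Xi unfolding free_holomorphic_def by blast
  then have KX: "K \<subseteq> \<Xi>" using K(2) by blast
  obtain x where x: "x \<in> K"
    and van: "\<And>p z. p \<in> A \<Longrightarrow> p x = 0\<^sub>m (dim_row x) (dim_row x) \<Longrightarrow> z \<in> K \<Longrightarrow> p z = 0\<^sub>m (dim_row z) (dim_row z)"
    using compact_nc_vanishing_point[OF K(1) False KX K(3)] by blast
  have xX: "x \<in> \<Xi>" using x KX by blast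
  obtain p where p: "p \<in> A" "f x = p x"
    using free_holomorphic_value_in_algebra[OF f e] x K(2) by blast
  have "f z = p z" if z: "z \<in> K" for z
  proof -
    have zX: "z \<in> \<Xi>" using z KX by blast
    define n m where "n = dim_row x" and "m = dim_row z"
    have xc: "x \<in> carrier_mat n n" and zc: "z \<in> carrier_mat m m"
      using in_Xi_carrier[OF xX] in_Xi_carrier[OF zX] by (auto simp: n_def m_def)
    let ?y = "direct_sum x z"
    have y: "?y \<in> K" using K(1) x z by (auto simp: nc_set_def)
    then have y\<Omega>: "?y \<in> \<Omega>" and yX: "?y \<in> \<Xi>" using K(2) KX by auto
    obtain q where q: "q \<in> A" "f ?y = q ?y"
      using free_holomorphic_value_in_algebra[OF f e y\<Omega>] by blast
    \<comment> \<open>The block formulas for \<open>f\<close> are available only inside a basic set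
      on which \<open>f\<close> is nc. One around the direct sum suffices, since it contains
      \<open>x\<close> and \<open>z\<close> as well.\<close>
    obtain Q where Q: "Q \<in> matrices_over A" "?y \<in> basic_free_open \<Xi> Q"
      and fQ: "nc_function scl (basic_free_open \<Xi> Q) f"
      using f y\<Omega> unfolding free_holomorphic_def by meson
    note s = summand_in_basic[OF Q(1) xX zX Q(2)]
    have fx: "f x = q x" and fz: "f z = q z"
      using nc_function_direct_sum(1,2)[OF fQ s Q(2) xc zc]
        nc_function_direct_sum(1,2)[OF algebra_nc[OF q(1)] xX zX yX xc zc] q(2) by simp_all
    \<comment> \<open>\<open>r\<close> realises \<open>p - q\<close> on \<open>\<Xi>\<close>; it
      vanishes at \<open>x\<close>, where \<open>p\<close> and \<open>q\<close> both equal
      \<open>f\<close>, and so on all of \<open>K\<close>.\<close>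
    obtain q' where q': "q' \<in> A" "\<And>w. w \<in> \<Xi> \<Longrightarrow> q' w = (-1) \<cdot>\<^sub>m q w"
      using algebra_smult[OF q(1)] by metis
    obtain r where r: "r \<in> A" "\<And>w. w \<in> \<Xi> \<Longrightarrow> r w = p w + q' w"
      using algebra_add[OF p(1) q'(1)] by metis
    note pz = algebra_carrier[OF p(1) zX zc] and qz = algebra_carrier[OF q(1) zX zc]
      and qx = algebra_carrier[OF q(1) xX xc]
    have "r x = 0\<^sub>m (dim_row x) (dim_row x)"
      unfolding r(2)[OF xX] q'(2)[OF xX] p(2)[symmetric] fx
      using qx by (intro eq_matI) (auto simp: n_def)
    then have "r z = 0\<^sub>m m m" using van[OF r(1) _ z] by (simp add: m_def)
    then have rz: "p z + (-1) \<cdot>\<^sub>m q z = 0\<^sub>m m m" by (simp add: r(2)[OF zX] q'(2)[OF zX])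
    have "p z = q z"
    proof (rule eq_matI)
      fix i j assume "i < dim_row (q z)" "j < dim_col (q z)"
      then have ij: "i < m" "j < m" using qz by auto
      have "(p z + (-1) \<cdot>\<^sub>m q z) $$ (i,j) = 0" unfolding rz using ij by simp
      then show "p z $$ (i,j) = q z $$ (i,j)" using ij pz qz by simp
    qed (use pz qz in auto)
    then show ?thesis using fz by simp
  qed
  then show ?thesis using p(1) by blast
qed

end

section \<open>Free polynomials\<close>

lemma nc_space_carrier: "x \<in> nc_space \<Longrightarrow> x \<in> carrier_mat (dim_row x) (dim_row x)"
  by (auto simp: nc_space_def)

lemma full_nc_space: "full_nc_set scl nc_space"
  by (auto simp: full_nc_set_def nc_set_def nc_space_def direct_sum_def)

lemma coord_mat_carrier: "x \<in> carrier_mat n m \<Longrightarrow> coord_mat x k \<in> carrier_mat n m"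
  by (simp add: coord_mat_def)

lemma word_eval_simps:
  "word_eval [] x = 1\<^sub>m (dim_row x)" "word_eval (k # w) x = coord_mat x k * word_eval w x"
  by (simp_all add: word_eval_def)

lemma word_eval_carrier: "x \<in> carrier_mat n n \<Longrightarrow> word_eval w x \<in> carrier_mat n n"
  by (induction w) (auto simp: word_eval_simps intro!: mult_carrier_mat coord_mat_carrier)

lemma word_eval_append:
  assumes x: "x \<in> carrier_mat n n"
  shows "word_eval (u @ w) x = word_eval u x * word_eval w x"
proof (induction u)
  case Nil
  then show ?case using word_eval_carrier[OF x, of w] x by (simp add: word_eval_simps)
next
  case (Cons k u)
  then show ?case
    using assoc_mult_mat[OF coord_mat_carrier[OF x] word_eval_carrier[OF x] word_eval_carrier[OF x], of k u w]
    by (simp add: word_eval_simps)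
qed

text \<open>An identity between matrices over \<open>\<complex>^d\<close> is read in coordinate
  \<open>k\<close>, where the left and right actions become ordinary matrix products.\<close>

lemma coord_mat_intertwines:
  assumes x: "x \<in> carrier_mat n n" and y: "y \<in> carrier_mat m m" and a: "\<alpha> \<in> carrier_mat m n"
    and eq: "left_act (*s) \<alpha> x = right_act (*s) y \<alpha>"
  shows "\<alpha> * coord_mat x k = coord_mat y k * \<alpha>"
proof (rule eq_matI)
  fix i j assume "i < dim_row (coord_mat y k * \<alpha>)" "j < dim_col (coord_mat y k * \<alpha>)"
  then have ij: "i < m" "j < n" using y a by (auto simp: coord_mat_def)
  have "vec_nth (left_act (*s) \<alpha> x $$ (i,j)) k = vec_nth (right_act (*s) y \<alpha> $$ (i,j)) k"
    by (simp only: eq)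
  then show "(\<alpha> * coord_mat x k) $$ (i,j) = (coord_mat y k * \<alpha>) $$ (i,j)"
    unfolding mult_mat_entry[OF a coord_mat_carrier[OF x] ij] mult_mat_entry[OF coord_mat_carrier[OF y] a ij]
    using ij x y a by (simp add: left_act_def right_act_def coord_mat_def mult.commute)
qed (use x y a in \<open>auto simp: coord_mat_def\<close>)

lemma word_eval_intertwines:
  assumes x: "x \<in> carrier_mat n n" and y: "y \<in> carrier_mat m m" and a: "\<alpha> \<in> carrier_mat m n"
    and eq: "left_act (*s) \<alpha> x = right_act (*s) y \<alpha>"
  shows "\<alpha> * word_eval w x = word_eval w y * \<alpha>"
proof (induction w)
  case Nil
  then show ?case using x y a by (simp add: word_eval_simps)
next
  case (Cons k w)
  note cx = coord_mat_carrier[OF x, of k] and cy = coord_mat_carrier[OF y, of k]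
    and wx = word_eval_carrier[OF x, of w] and wy = word_eval_carrier[OF y, of w]
  have "\<alpha> * (coord_mat x k * word_eval w x) = (\<alpha> * coord_mat x k) * word_eval w x"
    using assoc_mult_mat[OF a cx wx] by simp
  also have "\<dots> = coord_mat y k * (\<alpha> * word_eval w x)"
    unfolding coord_mat_intertwines[OF x y a eq] using assoc_mult_mat[OF cy a wx] by simp
  also have "\<dots> = (coord_mat y k * word_eval w y) * \<alpha>"
    unfolding Cons using assoc_mult_mat[OF cy wy a] by simp
  finally show ?case by (simp add: word_eval_simps)
qed

lemma free_poly_eval_dim [simp]:
  "dim_row (free_poly_eval p x) = dim_row x" "dim_col (free_poly_eval p x) = dim_row x"
  by (simp_all add: free_poly_eval_def)

text \<open>Enlarging the support adds only zero coefficients, so polynomials with different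
  supports can be evaluated over one common set of words.\<close>

lemma free_poly_eval_entry:
  assumes "i < dim_row x" "j < dim_row x" "finite W" "Poly_Mapping.keys p \<subseteq> W"
  shows "free_poly_eval p x $$ (i,j) = (\<Sum>w\<in>W. Poly_Mapping.lookup p w * word_eval w x $$ (i,j))"
  unfolding free_poly_eval_def using assms
  by (auto intro!: sum.mono_neutral_left simp: in_keys_iff)

lemma free_poly_eval_add:
  "free_poly_eval (p + q) x = free_poly_eval p x + free_poly_eval q x"
proof (rule eq_matI)
  fix i j assume "i < dim_row (free_poly_eval p x + free_poly_eval q x)"
    "j < dim_col (free_poly_eval p x + free_poly_eval q x)"
  then have ij: "i < dim_row x" "j < dim_row x" by simp_all
  let ?W = "Poly_Mapping.keys p \<union> Poly_Mapping.keys q"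
  have "Poly_Mapping.keys (p + q) \<subseteq> ?W" by (rule Poly_Mapping.keys_add)
  then show "free_poly_eval (p + q) x $$ (i,j) = (free_poly_eval p x + free_poly_eval q x) $$ (i,j)"
    using ij by (simp add: free_poly_eval_entry[where W = ?W] lookup_add distrib_right sum.distrib)
qed simp_all

lemma free_poly_eval_sum_entry:
  assumes "i < dim_row x" "j < dim_row x"
  shows "free_poly_eval (\<Sum>s\<in>S. P s) x $$ (i,j) = (\<Sum>s\<in>S. free_poly_eval (P s) x $$ (i,j))"
  using assms
  by (induction S rule: infinite_finite_induct) (simp_all add: free_poly_eval_add, simp_all add: free_poly_eval_def)

lemma free_poly_eval_single_entry:
  assumes "i < dim_row x" "j < dim_row x"
  shows "free_poly_eval (Poly_Mapping.single w c) x $$ (i,j) = c * word_eval w x $$ (i,j)"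
  using assms by (subst free_poly_eval_entry[where W = "{w}"]) auto

lemma free_poly_eval_one: "x \<in> nc_space \<Longrightarrow> free_poly_eval (Poly_Mapping.single [] 1) x = 1\<^sub>m (dim_row x)"
  by (intro eq_matI) (simp_all add: free_poly_eval_single_entry word_eval_simps)

lemma free_poly_eval_smult: "\<exists>r. \<forall>x\<in>nc_space. free_poly_eval r x = c \<cdot>\<^sub>m free_poly_eval p x"
proof (intro exI ballI)
  fix x :: "(complex ^ 'a) mat"
  let ?r = "\<Sum>w\<in>Poly_Mapping.keys p. Poly_Mapping.single w (c * Poly_Mapping.lookup p w)"
  show "free_poly_eval ?r x = c \<cdot>\<^sub>m free_poly_eval p x"
    by (intro eq_matI)
      (simp_all add: free_poly_eval_sum_entry free_poly_eval_single_entry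
        free_poly_eval_entry[where W = "Poly_Mapping.keys p" and p = p] sum_distrib_left mult.assoc)
qed

lemma free_poly_eval_mult: "\<exists>r. \<forall>x\<in>nc_space. free_poly_eval r x = free_poly_eval p x * free_poly_eval q x"
proof (intro exI ballI)
  fix x :: "(complex ^ 'a) mat" assume "x \<in> nc_space"
  define n where "n = dim_row x"
  have x: "x \<in> carrier_mat n n" unfolding n_def by (rule nc_space_carrier[OF \<open>x \<in> nc_space\<close>])
  let ?U = "Poly_Mapping.keys p" and ?V = "Poly_Mapping.keys q"
  \<comment> \<open>The convolution product over concatenation of words, matched to the matrix
    product by \<open>word_eval_append\<close>.\<close>
  let ?r = "\<Sum>u\<in>?U. \<Sum>v\<in>?V. Poly_Mapping.single (u @ v) (Poly_Mapping.lookup p u * Poly_Mapping.lookup q v)"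
  show "free_poly_eval ?r x = free_poly_eval p x * free_poly_eval q x"
  proof (rule eq_matI)
    fix i j assume "i < dim_row (free_poly_eval p x * free_poly_eval q x)"
      "j < dim_col (free_poly_eval p x * free_poly_eval q x)"
    then have ij: "i < n" "j < n" by (simp_all add: n_def)
    then have ij': "i < dim_row x" "j < dim_row x" by (simp_all add: n_def)
    have "(free_poly_eval p x * free_poly_eval q x) $$ (i,j) =
        (\<Sum>k<n. (\<Sum>u\<in>?U. Poly_Mapping.lookup p u * word_eval u x $$ (i,k)) *
          (\<Sum>v\<in>?V. Poly_Mapping.lookup q v * word_eval v x $$ (k,j)))"
      using ij by (subst mult_mat_entry[of _ n n _ n])
        (auto simp: n_def free_poly_eval_entry[where W = ?U and p = p] free_poly_eval_entry[where W = ?V and p = q]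
          intro!: carrier_matI sum.cong)
    also have "\<dots> = (\<Sum>k<n. \<Sum>u\<in>?U. \<Sum>v\<in>?V. Poly_Mapping.lookup p u * Poly_Mapping.lookup q v *
        (word_eval u x $$ (i,k) * word_eval v x $$ (k,j)))"
      unfolding sum_product by (intro sum.cong) (simp_all add: mult_ac)
    also have "\<dots> = (\<Sum>u\<in>?U. \<Sum>v\<in>?V. \<Sum>k<n. Poly_Mapping.lookup p u * Poly_Mapping.lookup q v *
        (word_eval u x $$ (i,k) * word_eval v x $$ (k,j)))"
      by (subst sum.swap, rule sum.cong[OF refl], rule sum.swap)
    also have "\<dots> = (\<Sum>u\<in>?U. \<Sum>v\<in>?V. Poly_Mapping.lookup p u * Poly_Mapping.lookup q v * word_eval (u @ v) x $$ (i,j))"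
      unfolding word_eval_append[OF x] mult_mat_entry[OF word_eval_carrier[OF x] word_eval_carrier[OF x] ij]
        sum_distrib_left ..
    also have "\<dots> = free_poly_eval ?r x $$ (i,j)"
      by (simp add: free_poly_eval_sum_entry[OF ij'] free_poly_eval_single_entry[OF ij'])
    finally show "free_poly_eval ?r x $$ (i,j) = (free_poly_eval p x * free_poly_eval q x) $$ (i,j)" ..
  qed simp_all
qed

lemma free_poly_eval_nc: "nc_function (*s) nc_space (free_poly_eval p)"
  unfolding nc_function_def graded_on_def
proof (intro conjI ballI impI)
  fix x :: "(complex ^ 'a) mat" assume "x \<in> nc_space"
  show "free_poly_eval p x \<in> carrier_mat (dim_row x) (dim_row x)" by (rule carrier_matI) simp_all
next
  fix x y :: "(complex ^ 'a) mat" and \<alpha> assume xy: "x \<in> nc_space" "y \<in> nc_space"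
    and a: "\<alpha> \<in> carrier_mat (dim_row y) (dim_row x)" and eq: "left_act (*s) \<alpha> x = right_act (*s) y \<alpha>"
  define n m where "n = dim_row x" and "m = dim_row y"
  have x: "x \<in> carrier_mat n n" and y: "y \<in> carrier_mat m m" and a: "\<alpha> \<in> carrier_mat m n"
    using nc_space_carrier xy a by (auto simp: n_def m_def)
  have px: "free_poly_eval p x \<in> carrier_mat n n" and py: "free_poly_eval p y \<in> carrier_mat m m"
    by (auto simp: n_def m_def)
  let ?W = "Poly_Mapping.keys p"
  show "\<alpha> * free_poly_eval p x = free_poly_eval p y * \<alpha>"
  proof (rule eq_matI)
    fix i j assume "i < dim_row (free_poly_eval p y * \<alpha>)" "j < dim_col (free_poly_eval p y * \<alpha>)"
    then have ij: "i < m" "j < n" using a py by auto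
    have "(\<alpha> * free_poly_eval p x) $$ (i,j) =
        (\<Sum>k<n. \<Sum>w\<in>?W. Poly_Mapping.lookup p w * (\<alpha> $$ (i,k) * word_eval w x $$ (k,j)))"
      unfolding mult_mat_entry[OF a px ij] using ij
      by (intro sum.cong) (simp_all add: n_def free_poly_eval_entry[where W = ?W] sum_distrib_left mult_ac)
    also have "\<dots> = (\<Sum>w\<in>?W. Poly_Mapping.lookup p w * (\<alpha> * word_eval w x) $$ (i,j))"
      unfolding mult_mat_entry[OF a word_eval_carrier[OF x] ij] sum_distrib_left by (rule sum.swap)
    also have "\<dots> = (\<Sum>w\<in>?W. Poly_Mapping.lookup p w * (word_eval w y * \<alpha>) $$ (i,j))"
      unfolding word_eval_intertwines[OF x y a eq] ..
    also have "\<dots> = (\<Sum>k<m. \<Sum>w\<in>?W. Poly_Mapping.lookup p w * (word_eval w y $$ (i,k) * \<alpha> $$ (k,j)))"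
      unfolding mult_mat_entry[OF word_eval_carrier[OF y] a ij] sum_distrib_left by (rule sum.swap)
    also have "\<dots> = (free_poly_eval p y * \<alpha>) $$ (i,j)"
      unfolding mult_mat_entry[OF py a ij] using ij
      by (intro sum.cong) (simp_all add: m_def free_poly_eval_entry[where W = ?W] sum_distrib_left sum_distrib_right mult_ac)
    finally show "(\<alpha> * free_poly_eval p x) $$ (i,j) = (free_poly_eval p y * \<alpha>) $$ (i,j)" .
  qed (use a px py in auto)
qed

lemma free_poly_algebra: "nc_function_algebra (*s) nc_space (range free_poly_eval)"
  unfolding nc_function_algebra_def
proof (intro conjI ballI allI)
  fix p q :: "(complex ^ 'a) mat \<Rightarrow> complex mat" and c :: complex
  assume "p \<in> range free_poly_eval"
  then obtain a where a: "p = free_poly_eval a" by blast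
  show "nc_function (*s) nc_space p" unfolding a by (rule free_poly_eval_nc)
  show "\<exists>r\<in>range free_poly_eval. \<forall>x\<in>nc_space. r x = c \<cdot>\<^sub>m p x"
    unfolding a using free_poly_eval_smult[of c a] by blast
  assume "q \<in> range free_poly_eval"
  then obtain b where b: "q = free_poly_eval b" by blast
  show "\<exists>r\<in>range free_poly_eval. \<forall>x\<in>nc_space. r x = p x + q x"
    unfolding a b using free_poly_eval_add[of a b] by blast
  show "\<exists>r\<in>range free_poly_eval. \<forall>x\<in>nc_space. r x = p x * q x"
    unfolding a b using free_poly_eval_mult[of a b] by blast
qed simp

theorem corollary3p2:
  shows "(\<forall>(scl :: complex \<Rightarrow> 'v::ab_group_add \<Rightarrow> 'v) \<Xi> A \<Omega> f K.
            vector_space scl \<and>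
            full_nc_set scl \<Xi> \<and>
            nc_function_algebra scl \<Xi> A \<and>
            (\<exists>e\<in>A. \<forall>x\<in>\<Xi>. e x = 1\<^sub>m (dim_row x)) \<and>
            openin (free_topology \<Xi> A) \<Omega> \<and>
            free_holomorphic scl \<Xi> A \<Omega> f \<and>
            nc_set K \<and> K \<subseteq> \<Omega> \<and>
            compactin (free_topology \<Xi> A) K
            \<longrightarrow> (\<exists>p\<in>A. \<forall>x\<in>K. f x = p x)) \<and>
         (\<forall>\<Omega> (f :: (complex ^ 'd) mat \<Rightarrow> complex mat) K.
            openin (free_topology nc_space (range free_poly_eval)) \<Omega> \<and>
            free_holomorphic (*s) nc_space (range free_poly_eval) \<Omega> f \<and>
            nc_set K \<and> K \<subseteq> \<Omega> \<and>
            compactin (free_topology nc_space (range free_poly_eval)) K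
            \<longrightarrow> (\<exists>p :: 'd free_poly. \<forall>x\<in>K. f x = free_poly_eval p x))"
proof (intro conjI allI impI; elim conjE)
  fix scl :: "complex \<Rightarrow> 'v::ab_group_add \<Rightarrow> 'v" and \<Xi> A \<Omega> f K
  assume "vector_space scl" "full_nc_set scl \<Xi>" "nc_function_algebra scl \<Xi> A"
  then interpret nc_algebra scl \<Xi> A
    by (simp add: nc_algebra_def complex_space_def nc_algebra_axioms_def)
  assume "\<exists>e\<in>A. \<forall>x\<in>\<Xi>. e x = 1\<^sub>m (dim_row x)" "free_holomorphic scl \<Xi> A \<Omega> f"
    "nc_set K" "K \<subseteq> \<Omega>" "compactin (free_topology \<Xi> A) K"
  then show "\<exists>p\<in>A. \<forall>x\<in>K. f x = p x" by (rule free_holomorphic_eq_on_compact)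
next
  fix \<Omega> and f :: "(complex ^ 'd) mat \<Rightarrow> complex mat" and K
  interpret nc_algebra "(*s)" "nc_space :: (complex ^ 'd) mat set" "range free_poly_eval"
    by (intro nc_algebra.intro complex_space.intro nc_algebra_axioms.intro
        vec.vector_space_axioms full_nc_space free_poly_algebra)
  have one: "\<exists>e\<in>range free_poly_eval. \<forall>x\<in>(nc_space :: (complex ^ 'd) mat set). e x = 1\<^sub>m (dim_row x)"
    using free_poly_eval_one by blast
  assume "free_holomorphic (*s) nc_space (range free_poly_eval) \<Omega> f"
    "nc_set K" "K \<subseteq> \<Omega>" "compactin (free_topology nc_space (range free_poly_eval)) K"
  from free_holomorphic_eq_on_compact[OF one this]
  show "\<exists>p. \<forall>x\<in>K. f x = free_poly_eval p x" by blast
qed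

end
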